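(* Given an $n$-node undirected graph $G$ and $c$ source nodes, for any parameters $1 \le c \le k \le n$, one can compute BFS trees rooted at each of the $c$ sources (i.e., solve $c$ instances of BFS) in the turnstile streaming model with probability $1-1/n^{\Omega(1)}$ using $\tilde{O}(n/k)$ passes and $\tilde{O}(cn + k^2)$ space.
   Context: Turnstile streaming model: the edges of the input graph are presented as a stream of edge insertions and deletions (the input is the final graph), read sequentially in passes; space is in bits. $\tilde{O}(x)$ denotes $O(x\cdot\mathrm{poly}\log n)$ or $O(x/\mathrm{poly}\log n)$. *)

theory Defs
  imports "HOL-Probability.Probability" "HOL-Library.Extended_Nat"
begin

text \<open>
  Randomized multi-pass streaming algorithms. The memory is a bit string, and it is all that survives
  from one step to the next: a coin flip that is used again later has to be stored in it.
  \<open>init\<close> receives the part of the input that is not streamed. Neither \<open>step\<close> nor \<open>end_pass\<close>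
  is told the number of the current pass or the non-streamed input, and \<open>result\<close> sees only the
  final memory.
\<close>

type_synonym mem = "bool list"

record ('i, 'u, 'o) stream_alg =
  init :: "'i \<Rightarrow> mem pmf"
  step :: "'u \<Rightarrow> mem \<Rightarrow> mem pmf"
  end_pass :: "mem \<Rightarrow> mem pmf"
  result :: "mem \<Rightarrow> 'o"

definition uses_space :: "('i, 'u, 'o) stream_alg \<Rightarrow> nat \<Rightarrow> bool" where
  "uses_space A s \<longleftrightarrow>
     (\<forall>i. \<forall>m \<in> set_pmf (init A i). length m = s) \<and>
     (\<forall>m. length m = s \<longrightarrow>
        (\<forall>u. \<forall>m' \<in> set_pmf (step A u m). length m' = s) \<and>
        (\<forall>m' \<in> set_pmf (end_pass A m). length m' = s))"

primrec run_pass :: "('i, 'u, 'o) stream_alg \<Rightarrow> 'u list \<Rightarrow> mem \<Rightarrow> mem pmf" where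
  "run_pass A [] m = end_pass A m"
| "run_pass A (u # us) m = bind_pmf (step A u m) (run_pass A us)"

primrec run_passes :: "('i, 'u, 'o) stream_alg \<Rightarrow> 'u list \<Rightarrow> nat \<Rightarrow> mem \<Rightarrow> mem pmf" where
  "run_passes A us 0 m = return_pmf m"
| "run_passes A us (Suc p) m = bind_pmf (run_pass A us m) (run_passes A us p)"

definition run_alg :: "('i, 'u, 'o) stream_alg \<Rightarrow> nat \<Rightarrow> 'i \<Rightarrow> 'u list \<Rightarrow> 'o pmf" where
  "run_alg A p i us = map_pmf (result A) (bind_pmf (init A i) (run_passes A us p))"


text \<open>
  Undirected simple graphs on the nodes \<open>{..<n}\<close>, given by their sets of two-element edges. As in the
  general (not the strict) turnstile model, only the net multiplicities at the end of the stream
  are constrained, not those of its prefixes.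
\<close>

datatype 'e update = Insert 'e | Delete 'e

primrec update_item :: "'e update \<Rightarrow> 'e" where
  "update_item (Insert e) = e"
| "update_item (Delete e) = e"

definition all_edges :: "nat \<Rightarrow> nat set set" where
  "all_edges n = {{u, v} | u v. u < n \<and> v < n \<and> u \<noteq> v}"

definition net_mult :: "'e update list \<Rightarrow> 'e \<Rightarrow> int" where
  "net_mult us e = int (count_list us (Insert e)) - int (count_list us (Delete e))"

definition final_graph :: "'e update list \<Rightarrow> 'e set" where
  "final_graph us = {e. net_mult us e = 1}"

definition turnstile_stream :: "nat \<Rightarrow> nat set update list \<Rightarrow> bool" where
  "turnstile_stream n us \<longleftrightarrow>
     update_item ` set us \<subseteq> all_edges n \<and> (\<forall>e. net_mult us e \<in> {0, 1})"


definition walk :: "'v set set \<Rightarrow> 'v \<Rightarrow> 'v \<Rightarrow> 'v list \<Rightarrow> bool" where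
  "walk E u v xs \<longleftrightarrow>
     xs \<noteq> [] \<and> hd xs = u \<and> last xs = v \<and> successively (\<lambda>a b. {a, b} \<in> E) xs"

definition cycle :: "'v set set \<Rightarrow> 'v list \<Rightarrow> bool" where
  "cycle E xs \<longleftrightarrow>
     length xs \<ge> 3 \<and> distinct xs \<and> successively (\<lambda>a b. {a, b} \<in> E) xs \<and> {last xs, hd xs} \<in> E"

definition graph_dist :: "'v set set \<Rightarrow> 'v \<Rightarrow> 'v \<Rightarrow> enat" where
  "graph_dist E u v = (INF xs \<in> {xs. walk E u v xs}. enat (length xs - 1))"

definition component :: "'v set set \<Rightarrow> 'v \<Rightarrow> 'v set" where
  "component E r = {v. \<exists>xs. walk E r v xs}"

definition is_tree :: "'v set \<Rightarrow> 'v set set \<Rightarrow> bool" where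
  "is_tree V T \<longleftrightarrow>
     V \<noteq> {} \<and> T \<subseteq> {{u, v} | u v. u \<in> V \<and> v \<in> V \<and> u \<noteq> v} \<and>
     (\<forall>u\<in>V. \<forall>v\<in>V. \<exists>xs. walk T u v xs) \<and> (\<nexists>xs. cycle T xs)"

text \<open>The graph need not be connected: a BFS tree spans the component of its root.\<close>

definition bfs_tree :: "'v set set \<Rightarrow> 'v \<Rightarrow> 'v set set \<Rightarrow> bool" where
  "bfs_tree E r T \<longleftrightarrow>
     T \<subseteq> E \<and> is_tree (component E r) T \<and>
     (\<forall>v\<in>component E r. graph_dist T r v = graph_dist E r v)"


text \<open>
  \<open>soft_O D N g\<close> is the class of functions bounded by \<open>g\<close> up to a constant and a polylogarithmic factor
  in the size \<open>N x\<close>, uniformly over all parameters \<open>x \<in> D\<close>. Writing \<open>1 + log 2 (N x)\<close> instead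
  of \<open>log 2 (N x)\<close> only avoids the degenerate value \<open>0\<close> at size \<open>1\<close>.
\<close>

definition soft_O :: "'p set \<Rightarrow> ('p \<Rightarrow> nat) \<Rightarrow> ('p \<Rightarrow> real) \<Rightarrow> ('p \<Rightarrow> real) set" where
  "soft_O D N g =
     {f. \<exists>(C::real) (a::nat). \<forall>x\<in>D. \<bar>f x\<bar> \<le> C * \<bar>g x\<bar> * (1 + log 2 (real (N x))) ^ a}"

end

theory Submission
  imports Defs "HOL-Library.Log_Nat"
begin

text \<open>
  Take the sources together with \<open>k\<close> random nodes as hubs. With high probability every geodesic of length
  about \<open>(n / k) log n\<close> contains a hub, so all distances from the sources are determined by the
  distances of that order around the hubs. These are explored by simultaneous breadth-first searches,
  one from each hub, of which only the last two layers are kept. The search from each hub is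
  started with a random delay below \<open>n / k\<close>; then at any time a given vertex is in the current layer of
  only about \<open>k\<^sup>2 / n + log n\<close> searches, so that the layers fit into the space \<open>n + k\<^sup>2\<close> up to logarithms.

  A first sweep finds the distances between nearby hubs, hence the distances from the sources to
  all hubs; a second sweep with the same delays combines these into the distances from the sources to all
  vertices. A parent of every vertex in every tree is then found by bisection. A pass only ever asks
  whether the final graph meets certain sets of edges, which linear counters answer exactly. The next layer
  is found by bisecting the hub indices in logarithmically many passes. Thus randomness is used only for the
  hubs and the delays, and both are stored.
\<close>

section \<open>Distances and breadth-first search trees\<close>

text \<open>The distances from all hubs to all vertices would take about \<open>k * n\<close>
  entries, too many for the space bound, while the \<open>k ^ 2\<close> distances between hubs fit.
  This is why the exploration is run twice: the second sweep regenerates the distances from hubs to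
  vertices layer by layer and consumes each of them at once. Without delays, all searches could be
  at the same vertices at the same time, again about \<open>k * n\<close> pairs. A uniform delay
  puts a search at a given vertex at a given time with probability \<open>O(k / n)\<close>, so about
  \<open>k\<close> searches load a vertex with \<open>O(k ^ 2 / n)\<close> pairs on average, and all
  vertices together with \<open>O(k ^ 2)\<close>. One counter for every hub and vertex would cost
  \<open>k * n\<close> once more; bisecting the indices keeps the number of counters within twice
  the bound on a layer.\<close>

definition reach :: "'v set set \<Rightarrow> nat \<Rightarrow> 'v \<Rightarrow> 'v \<Rightarrow> bool" where
  "reach E a u v \<longleftrightarrow> (\<exists>xs. walk E u v xs \<and> length xs = Suc a)"

lemma reach_0 [simp]: "reach E 0 u v \<longleftrightarrow> u = v"
  by (auto simp: reach_def walk_def length_Suc_conv intro: exI[of _ "[u]"])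

lemma reach_Suc: "reach E (Suc a) u v \<longleftrightarrow> (\<exists>w. reach E a u w \<and> {w, v} \<in> E)"
proof
  assume "reach E (Suc a) u v"
  then obtain xs where xs: "walk E u v xs" "length xs = Suc (Suc a)"
    by (auto simp: reach_def)
  then obtain ys y where ys: "xs = ys @ [y]"
    by (metis length_Suc_conv_rev)
  with xs have "ys \<noteq> []" by auto
  with xs ys have "walk E u (last ys) ys" "{last ys, v} \<in> E" "length ys = Suc a"
    by (auto simp: walk_def successively_append_iff)
  then show "\<exists>w. reach E a u w \<and> {w, v} \<in> E"
    by (auto simp: reach_def)
next
  assume "\<exists>w. reach E a u w \<and> {w, v} \<in> E"
  then obtain w xs where xs: "walk E u w xs" "length xs = Suc a" "{w, v} \<in> E"
    by (auto simp: reach_def)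
  then have "walk E u v (xs @ [v])"
    by (auto simp: walk_def successively_append_iff)
  with xs show "reach E (Suc a) u v"
    by (auto simp: reach_def intro!: exI[of _ "xs @ [v]"])
qed

lemma reach_add: "reach E (a + b) u v \<longleftrightarrow> (\<exists>w. reach E a u w \<and> reach E b w v)"
  by (induction b arbitrary: v) (auto simp: reach_Suc)

lemma reach_sym: "reach E a u v \<Longrightarrow> reach E a v u"
proof (induction a arbitrary: v)
  case (Suc a)
  then obtain w where "reach E a u w" "{w, v} \<in> E" by (auto simp: reach_Suc)
  moreover from this have "reach E (Suc 0) v w" by (simp add: reach_Suc insert_commute)
  ultimately show ?case using reach_add[of E "Suc 0" a v u] Suc.IH by auto
qed simp

lemma reach_mono: "E \<subseteq> E' \<Longrightarrow> reach E a u v \<Longrightarrow> reach E' a u v"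
  by (induction a arbitrary: v) (auto simp: reach_Suc)

lemma walk_iff_reach: "(\<exists>xs. walk E u v xs) \<longleftrightarrow> (\<exists>a. reach E a u v)"
proof
  assume "\<exists>xs. walk E u v xs"
  then obtain xs where "walk E u v xs" by blast
  then have "walk E u v xs \<and> length xs = Suc (length xs - 1)" by (auto simp: walk_def)
  then show "\<exists>a. reach E a u v" unfolding reach_def by blast
qed (auto simp: reach_def)

lemma graph_dist_le: "reach E a u v \<Longrightarrow> graph_dist E u v \<le> enat a"
  by (auto simp: graph_dist_def reach_def intro!: INF_lower2)

lemma reach_graph_dist:
  assumes "graph_dist E u v = enat a" shows "reach E a u v"
proof -
  let ?L = "(\<lambda>xs. enat (length xs - 1)) ` {xs. walk E u v xs}"
  have "?L \<noteq> {}"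
  proof
    assume "?L = {}"
    then have "graph_dist E u v = Inf {}" unfolding graph_dist_def by (rule arg_cong)
    then show False using assms by (simp add: top_enat_def)
  qed
  then have "Inf ?L \<in> ?L"
    unfolding Inf_enat_def by (metis (no_types, lifting) LeastI ex_in_conv)
  then obtain xs where "walk E u v xs" "enat a = enat (length xs - 1)"
    using assms by (auto simp: graph_dist_def)
  then show ?thesis by (auto simp: reach_def walk_def intro!: exI[of _ xs])
qed

lemma component_iff: "v \<in> component E r \<longleftrightarrow> graph_dist E r v \<noteq> \<infinity>"
proof -
  have "v \<in> component E r \<longleftrightarrow> (\<exists>a. reach E a r v)"
    by (simp add: component_def walk_iff_reach)
  also have "\<dots> \<longleftrightarrow> graph_dist E r v \<noteq> \<infinity>"
    using graph_dist_le[of E _ r v] reach_graph_dist[of E r v]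
    by (metis enat_ord_simps(5) not_infinity_eq)
  finally show ?thesis .
qed

lemma graph_dist_self [simp]: "graph_dist E u u = 0"
  using graph_dist_le[of E 0 u u] by (simp add: zero_enat_def[symmetric])

lemma graph_dist_eq_0_iff [simp]: "graph_dist E u v = 0 \<longleftrightarrow> u = v"
  using reach_graph_dist[of E u v 0] by (auto simp: zero_enat_def[symmetric])

lemma graph_dist_triangle: "graph_dist E u w \<le> graph_dist E u v + graph_dist E v w"
proof (cases "graph_dist E u v"; cases "graph_dist E v w")
  fix a b assume "graph_dist E u v = enat a" "graph_dist E v w = enat b"
  then show ?thesis
    using graph_dist_le[of E "a + b" u w] reach_add[of E a b u w] reach_graph_dist by fastforce
qed auto

lemma graph_dist_edge:
  assumes "{u, v} \<in> E" shows "graph_dist E r v \<le> graph_dist E r u + 1"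
proof -
  have "graph_dist E u v \<le> 1"
    using graph_dist_le[of E "Suc 0" u v] assms by (simp add: reach_Suc one_enat_def)
  then show ?thesis
    using graph_dist_triangle[of E r v u] by (meson add_left_mono order_trans)
qed

text \<open>Cut a shortest walk after \<open>a\<close> steps; by the triangle inequality neither
  part can be shorter than its share.\<close>

lemma graph_dist_split:
  assumes "graph_dist E u v = enat (a + b)"
  obtains w where "graph_dist E u w = enat a" "graph_dist E w v = enat b"
proof -
  obtain w where "reach E a u w" "reach E b w v"
    using reach_graph_dist[OF assms] by (auto simp: reach_add)
  then have "graph_dist E u w \<le> enat a" "graph_dist E w v \<le> enat b"
    by (auto intro: graph_dist_le)
  moreover have "enat (a + b) \<le> graph_dist E u w + graph_dist E w v"
    using graph_dist_triangle[of E u v w] assms by simp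
  ultimately have "graph_dist E u w = enat a \<and> graph_dist E w v = enat b"
    by (cases "graph_dist E u w"; cases "graph_dist E w v") auto
  then show ?thesis using that by blast
qed

lemma graph_dist_pred:
  assumes "graph_dist E r v = enat (Suc a)"
  obtains w where "{w, v} \<in> E" "graph_dist E r w = enat a"
proof -
  obtain w where "graph_dist E r w = enat a" "graph_dist E w v = enat (Suc 0)"
    using graph_dist_split[of E r v a "Suc 0"] assms by auto
  then show ?thesis using reach_graph_dist[of E w v "Suc 0"] that by (auto simp: reach_Suc)
qed

lemma graph_dist_antimono:
  assumes "E \<subseteq> E'" shows "graph_dist E' u v \<le> graph_dist E u v"
proof (cases "graph_dist E u v")
  case (enat a)
  then show ?thesis using graph_dist_le[OF reach_mono[OF assms reach_graph_dist[OF enat]]] by simp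
qed simp

lemma finite_graph_dist_imp_less:
  assumes "E \<subseteq> all_edges n" "u < n" "graph_dist E u v = enat a" shows "v < n"
proof (cases a)
  case 0
  then show ?thesis using assms by (auto simp: zero_enat_def[symmetric])
next
  case (Suc b)
  then obtain w where "{w, v} \<in> E" using graph_dist_pred[of E u v b] assms(3) by auto
  then show ?thesis using assms(1) by (auto simp: all_edges_def doubleton_eq_iff)
qed

text \<open>The vertices on a geodesic from \<open>u\<close> to \<open>v\<close> have pairwise distinct distances from \<open>u\<close>.\<close>

lemma card_geodesic_ge:
  assumes "E \<subseteq> all_edges n" "u < n" "graph_dist E u v = enat a"
  shows "Suc a \<le> card {x. x < n \<and> graph_dist E u x + graph_dist E x v = enat a}" (is "_ \<le> card ?X")
proof -
  have "{..a} \<subseteq> (\<lambda>x. the_enat (graph_dist E u x)) ` ?X"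
  proof
    fix b assume "b \<in> {..a}"
    then have "graph_dist E u v = enat (b + (a - b))" using assms by simp
    then obtain w where w: "graph_dist E u w = enat b" "graph_dist E w v = enat (a - b)"
      by (rule graph_dist_split)
    moreover have "w < n" using finite_graph_dist_imp_less[OF assms(1,2) w(1)] .
    ultimately have "w \<in> ?X" "b = the_enat (graph_dist E u w)" using \<open>b \<in> {..a}\<close> by auto
    then show "b \<in> (\<lambda>x. the_enat (graph_dist E u x)) ` ?X" by blast
  qed
  then have "card {..a} \<le> card ?X"
    by (intro surj_card_le[OF _ ]) auto
  then show ?thesis by simp
qed

lemma graph_dist_less:
  assumes "E \<subseteq> all_edges n" "u < n" "graph_dist E u v = enat a" shows "a < n"
proof -
  have "Suc a \<le> card {x. x < n \<and> graph_dist E u x + graph_dist E x v = enat a}"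
    by (rule card_geodesic_ge[OF assms])
  also have "\<dots> \<le> card {..<n}" by (intro card_mono) auto
  finally show ?thesis by simp
qed

lemma cycle_edges:
  assumes "cycle E xs" "i < length xs"
  shows "{xs ! i, xs ! (Suc i mod length xs)} \<in> E"
proof (cases "Suc i < length xs")
  case True
  then show ?thesis using assms by (auto simp: cycle_def successively_conv_nth)
next
  case False
  then have "Suc i = length xs" using assms by simp
  moreover from this have "xs \<noteq> []" by auto
  ultimately have "xs ! i = last xs" "xs ! (Suc i mod length xs) = hd xs"
    by (simp_all add: last_conv_nth hd_conv_nth flip: \<open>Suc i = length xs\<close>)
  then show ?thesis using assms by (simp add: cycle_def)
qed

text \<open>Following parents descends the depths one by one, so the parent edges contain a shortest
  walk to every vertex of the component; this gives connectivity and the distances at once. A cycle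
  fails at its deepest vertex, both of whose neighbours on the cycle would have to be its
  parent.\<close>

lemma bfs_tree_of_parents:
  fixes E :: "'v set set"
  assumes par: "\<And>v. v \<in> component E r \<Longrightarrow> v \<noteq> r \<Longrightarrow>
     {par v, v} \<in> E \<and> graph_dist E r (par v) + 1 = graph_dist E r v"
  shows "bfs_tree E r {{par v, v} | v. v \<in> component E r \<and> v \<noteq> r}" 
proof -
  define T where "T = {{par v, v} | v. v \<in> component E r \<and> v \<noteq> r}"
  let ?V = "component E r" and ?d = "graph_dist E r"
  have TE: "T \<subseteq> E" using par by (auto simp: T_def)
  have r: "r \<in> ?V" by (simp add: component_iff)
  have parV: "par v \<in> ?V \<and> par v \<noteq> v" if "v \<in> ?V" "v \<noteq> r" for v
  proof -
    have "?d (par v) + 1 = ?d v" "?d v \<noteq> \<infinity>" using par that by (auto simp: component_iff)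
    then show ?thesis by (cases "?d (par v)") (auto simp: component_iff one_enat_def)
  qed
  have reachT: "reach T a r v" if "?d v = enat a" for a v
    using that
  proof (induction a arbitrary: v)
    case 0
    then show ?case by (simp add: zero_enat_def[symmetric])
  next
    case (Suc a)
    then have v: "v \<in> ?V" "v \<noteq> r" by (auto simp: component_iff zero_enat_def)
    with par Suc.prems have "?d (par v) + 1 = enat (Suc a)" by auto
    then have "?d (par v) = enat a" by (cases "?d (par v)") (auto simp: one_enat_def)
    then have "reach T a r (par v)" by (rule Suc.IH)
    moreover have "{par v, v} \<in> T" using v by (auto simp: T_def)
    ultimately show ?case by (auto simp: reach_Suc)
  qed
  have conn: "\<exists>xs. walk T u v xs" if "u \<in> ?V" "v \<in> ?V" for u v
  proof -
    obtain a b where "?d u = enat a" "?d v = enat b" using \<open>u \<in> ?V\<close> \<open>v \<in> ?V\<close>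
      by (auto simp: component_iff)
    then have "reach T a u r" "reach T b r v" by (simp_all add: reachT reach_sym[OF reachT])
    then have "reach T (a + b) u v" unfolding reach_add by (intro exI conjI)
    then show ?thesis unfolding walk_iff_reach by (rule exI)
  qed
  have acyclic: False if cyc: "cycle T xs" for xs
  proof -
    let ?l = "length xs"
    have l: "?l \<ge> 3" "distinct xs" using cyc by (auto simp: cycle_def)
    let ?D = "\<lambda>i. ?d (xs ! i)"
    have "\<exists>i\<in>{..<?l}. \<forall>j\<in>{..<?l}. ?D j \<le> ?D i"
    proof -
      have ne: "?D ` {..<?l} \<noteq> {}" "finite (?D ` {..<?l})" using l by (auto simp: lessThan_empty_iff)
      have "Max (?D ` {..<?l}) \<in> ?D ` {..<?l}" by (rule Max_in[OF ne(2,1)])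
      then obtain i where i: "i \<in> {..<?l}" "?D i = Max (?D ` {..<?l})" by force
      have "\<forall>j\<in>{..<?l}. ?D j \<le> ?D i" unfolding i(2) using ne by (auto intro: Max_ge)
      then show ?thesis using i(1) by blast
    qed
    then obtain i where i: "i < ?l" and max: "\<And>j. j < ?l \<Longrightarrow> ?D j \<le> ?D i" by auto
    txt \<open>A tree edge at a vertex of maximal depth leads to the parent of that vertex.\<close>
    have up: "xs ! j = par (xs ! i)" if j: "j < ?l" and e: "{xs ! i, xs ! j} \<in> T" for j
    proof -
      obtain v where v: "{xs ! i, xs ! j} = {par v, v}" "v \<in> ?V" "v \<noteq> r" using e by (auto simp: T_def)
      have "?d (par v) + 1 = ?d v" "?d v \<noteq> \<infinity>" using par v by (auto simp: component_iff)
      then have "?d (par v) < ?d v" by (cases "?d v"; cases "?d (par v)") (auto simp: one_enat_def)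
      then have "xs ! j \<noteq> v \<or> xs ! i \<noteq> par v" using max[OF j] by auto
      then show ?thesis using v(1) by (auto simp: doubleton_eq_iff)
    qed
    \<comment> \<open>\<open>j\<close> and \<open>h\<close> are the cyclic successor and predecessor
      of \<open>i\<close>; they differ because a cycle has at least three vertices.\<close>
    define j where "j = Suc i mod ?l"
    define h where "h = (if i = 0 then ?l - 1 else i - 1)"
    have "j < ?l" "h < ?l" "Suc h mod ?l = i" using l i by (auto simp: j_def h_def mod_Suc)
    have "j \<noteq> h" using l i by (auto simp: j_def h_def mod_Suc)
    have "xs ! j = par (xs ! i)"
      using up[OF \<open>j < ?l\<close>] cycle_edges[OF cyc i] by (simp add: j_def)
    moreover have "xs ! h = par (xs ! i)"
      using up[OF \<open>h < ?l\<close>] cycle_edges[OF cyc \<open>h < ?l\<close>] \<open>Suc h mod ?l = i\<close>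
      by (simp add: insert_commute)
    ultimately show False
      using l \<open>j \<noteq> h\<close> \<open>j < ?l\<close> \<open>h < ?l\<close> by (metis nth_eq_iff_index_eq)
  qed
  have "T \<subseteq> {{u, v} | u v. u \<in> ?V \<and> v \<in> ?V \<and> u \<noteq> v}" using parV by (fastforce simp: T_def)
  then have tree: "is_tree ?V T"
    unfolding is_tree_def using r by (intro conjI ballI conn notI) (auto dest: acyclic)
  have "graph_dist T r v = ?d v" if "v \<in> ?V" for v
  proof (rule antisym)
    obtain a where "?d v = enat a" using \<open>v \<in> ?V\<close> by (auto simp: component_iff)
    then show "graph_dist T r v \<le> ?d v" using graph_dist_le[OF reachT] by metis
  qed (rule graph_dist_antimono[OF TE])
  with TE tree show ?thesis unfolding bfs_tree_def T_def[symmetric] by (intro conjI ballI)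
qed

section \<open>Programs of edge-set queries as streaming algorithms\<close>

datatype ('s, 'l, 'e) pass_instr =
  Pass (labels: "'s \<Rightarrow> 'l set") (query: "'s \<Rightarrow> 'l \<Rightarrow> 'e set") (update: "'s \<Rightarrow> ('l \<Rightarrow> bool) \<Rightarrow> 's")

definition answer :: "'e set \<Rightarrow> ('s, 'l, 'e) pass_instr \<Rightarrow> 's \<Rightarrow> 'l \<Rightarrow> bool" where
  "answer G I s l \<longleftrightarrow> l \<in> labels I s \<and> G \<inter> query I s l \<noteq> {}"

text \<open>Trajectories that stay within the state space \<open>\<Sigma>\<close> and the query budget \<open>B\<close>. Only these have to be
  followed by the compiled streaming algorithm.\<close>

inductive runs :: "'e set \<Rightarrow> 's set \<Rightarrow> nat \<Rightarrow> ('s, 'l, 'e) pass_instr list \<Rightarrow> 's \<Rightarrow> 's \<Rightarrow> bool"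
  for G :: "'e set" and \<Sigma> :: "'s set" and B :: nat where
  runs_Nil: "runs G \<Sigma> B [] s s"
| runs_Cons: "finite (labels I s) \<Longrightarrow> card (labels I s) \<le> B \<Longrightarrow> update I s (answer G I s) = s' \<Longrightarrow>
    s' \<in> \<Sigma> \<Longrightarrow> runs G \<Sigma> B p s' s'' \<Longrightarrow> runs G \<Sigma> B (I # p) s s''"

lemma runs_append:
  "runs G \<Sigma> B p s s' \<Longrightarrow> runs G \<Sigma> B p' s' s'' \<Longrightarrow> runs G \<Sigma> B (p @ p') s s''"
  by (induction rule: runs.induct) (auto intro: runs.intros)

primrec update_sign :: "'e update \<Rightarrow> int" where
  "update_sign (Insert e) = 1"
| "update_sign (Delete e) = - 1"

lemma final_graph_subset:
  assumes "update_item ` set us \<subseteq> E" shows "final_graph us \<subseteq> E"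
proof
  fix e assume "e \<in> final_graph us"
  then have "count_list us (Insert e) \<noteq> 0" by (auto simp: final_graph_def net_mult_def)
  then have "Insert e \<in> set us" by (meson count_list_0_iff)
  then show "e \<in> E" using assms by force
qed

text \<open>By linearity the order of the updates is irrelevant, so prefixes with negative
  multiplicities do no harm. At the end the net multiplicities are the indicator function of the
  final graph.\<close>

lemma sum_list_updates:
  assumes "finite E" "update_item ` set us \<subseteq> E" "\<And>e. net_mult us e \<in> {0, 1}"
  shows "(\<Sum>u\<leftarrow>us. update_sign u * of_bool (update_item u \<in> X)) = int (card (final_graph us \<inter> X))"
proof -
  \<comment> \<open>Stated without the hypothesis on the net multiplicities, which tails of the
    stream may violate.\<close>
  have gen: "(\<Sum>u\<leftarrow>us. update_sign u * of_bool (update_item u \<in> X)) = (\<Sum>e\<in>E. net_mult us e * of_bool (e \<in> X))"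
    if "update_item ` set us \<subseteq> E" for us :: "'a update list"
    using that
  proof (induction us)
    case Nil
    then show ?case by (simp add: net_mult_def)
  next
    case (Cons u us)
    have *: "net_mult (u # us) e = net_mult us e + update_sign u * of_bool (e = update_item u)" for e
      by (cases u) (auto simp: net_mult_def)
    have "update_item u \<in> E" using Cons.prems by auto
    have "(\<Sum>e\<in>E. net_mult (u # us) e * of_bool (e \<in> X)) =
      (\<Sum>e\<in>E. net_mult us e * of_bool (e \<in> X)) + (\<Sum>e\<in>E. if e = update_item u then update_sign u * of_bool (e \<in> X) else 0)"
      unfolding * sum.distrib[symmetric] by (intro sum.cong) (auto simp: algebra_simps)
    also have "(\<Sum>e\<in>E. if e = update_item u then update_sign u * of_bool (e \<in> X) else 0) =
      update_sign u * of_bool (update_item u \<in> X)"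
      using \<open>update_item u \<in> E\<close> assms(1) by (subst sum.delta) auto
    finally show ?case using Cons by simp
  qed
  have "(\<Sum>e\<in>E. net_mult us e * of_bool (e \<in> X)) = (\<Sum>e\<in>E. of_bool (e \<in> final_graph us \<inter> X))"
    using assms(3) by (intro sum.cong) (auto simp: final_graph_def)
  also have "\<dots> = int (card (E \<inter> {e. e \<in> final_graph us \<inter> X}))"
    using assms(1) by (subst sum_of_bool_eq) auto
  also have "E \<inter> {e. e \<in> final_graph us \<inter> X} = final_graph us \<inter> X"
    using final_graph_subset[OF assms(2)] by auto
  finally show ?thesis using gen[OF assms(2)] by simp
qed

text \<open>
  The answer to a query is read off a counter, modulo \<open>M\<close>, of the net number of insertions into the
  queried set; this is exact at the end of a pass because \<open>M\<close> exceeds the number of possible items.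
  Space is counted non-constructively: the memory is an arbitrary injective encoding of the
  configurations, which consist of the program counter, the state and the counters.
\<close>

locale pass_program =
  fixes \<Sigma> :: "'s set" and B :: nat and prog :: "('s, 'l, 'e) pass_instr list"
    and M b :: nat and start :: "'i \<Rightarrow> 's pmf" and out :: "'s \<Rightarrow> 'o"
  assumes finite_states: "finite \<Sigma>" and start: "\<And>i. set_pmf (start i) \<subseteq> \<Sigma>"
    and M_pos: "M > 0" and states_le: "Suc (length prog) * card \<Sigma> * M ^ B \<le> 2 ^ b"
begin

text \<open>An instruction over budget gets no counters, so that the configurations stay few in
  every state, also in those off the trajectories of \<open>runs\<close>.\<close>

definition live_labels :: "nat \<Rightarrow> 's \<Rightarrow> 'l set" where
  "live_labels pc s = (if pc < length prog \<and> finite (labels (prog ! pc) s) \<and> card (labels (prog ! pc) s) \<le> B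
     then labels (prog ! pc) s else {})"

definition configs :: "((nat \<times> 's) \<times> ('l \<Rightarrow> int)) set" where
  "configs = Sigma ({..length prog} \<times> \<Sigma>) (\<lambda>(pc, s). PiE (live_labels pc s) (\<lambda>_. {0..<int M}))"

definition fresh :: "nat \<Rightarrow> 's \<Rightarrow> (nat \<times> 's) \<times> ('l \<Rightarrow> int)" where
  "fresh pc s = ((pc, s), \<lambda>l\<in>live_labels pc s. 0)"

fun stepc :: "'e update \<Rightarrow> (nat \<times> 's) \<times> ('l \<Rightarrow> int) \<Rightarrow> (nat \<times> 's) \<times> ('l \<Rightarrow> int)" where
  "stepc u ((pc, s), f) = ((pc, s), \<lambda>l\<in>live_labels pc s.
     (f l + update_sign u * of_bool (update_item u \<in> query (prog ! pc) s l)) mod int M)"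

text \<open>Made total so that \<open>configs\<close> is closed under it. The fallback to the old
  state never happens along \<open>runs\<close>.\<close>

fun endc :: "(nat \<times> 's) \<times> ('l \<Rightarrow> int) \<Rightarrow> (nat \<times> 's) \<times> ('l \<Rightarrow> int)" where
  "endc ((pc, s), f) = (if pc < length prog
     then let s' = update (prog ! pc) s (\<lambda>l. l \<in> live_labels pc s \<and> f l \<noteq> 0)
          in fresh (Suc pc) (if s' \<in> \<Sigma> then s' else s)
     else ((pc, s), f))"

lemma live_labels: "finite (live_labels pc s)" "card (live_labels pc s) \<le> B"
  by (auto simp: live_labels_def)

lemma finite_configs: "finite configs"
  unfolding configs_def using finite_states live_labels
  by (auto intro!: finite_SigmaI finite_PiE)

lemma card_configs: "card configs \<le> 2 ^ b"
proof -
  have "card configs = (\<Sum>x\<in>{..length prog} \<times> \<Sigma>. card (case x of (pc, s) \<Rightarrow> PiE (live_labels pc s) (\<lambda>_. {0..<int M})))"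
    unfolding configs_def using finite_states live_labels
    by (subst card_SigmaI) (auto intro!: finite_PiE)
  also have "\<dots> \<le> (\<Sum>x\<in>{..length prog} \<times> \<Sigma>. M ^ B)"
    using live_labels M_pos
    by (intro sum_mono) (auto simp: card_PiE intro!: power_increasing)
  also have "\<dots> = Suc (length prog) * card \<Sigma> * M ^ B" by (simp add: card_cartesian_product)
  finally show ?thesis using states_le by simp
qed

definition enc :: "(nat \<times> 's) \<times> ('l \<Rightarrow> int) \<Rightarrow> mem" where
  "enc = (SOME f. inj_on f configs \<and> f ` configs \<subseteq> {xs. length xs = b})"

lemma enc: "inj_on enc configs" "c \<in> configs \<Longrightarrow> length (enc c) = b"
proof -
  have eq: "{xs :: mem. length xs = b} = {xs. set xs \<subseteq> (UNIV :: bool set) \<and> length xs = b}" by simp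
  have "card configs \<le> card {xs :: mem. length xs = b}"
    unfolding eq using card_configs by (subst card_lists_length_eq) auto
  then have "\<exists>f. inj_on f configs \<and> f ` configs \<subseteq> {xs :: mem. length xs = b}"
    using finite_configs finite_lists_length_eq[of "UNIV :: bool set" b]
    by (metis eq finite_code card_le_inj)
  from someI_ex[OF this] show "inj_on enc configs" "c \<in> configs \<Longrightarrow> length (enc c) = b"
    by (auto simp: enc_def)
qed

text \<open>\<open>uses_space\<close> quantifies over all strings of the right length, so strings
  that encode no configuration are left unchanged.\<close>

definition lift :: "((nat \<times> 's) \<times> ('l \<Rightarrow> int) \<Rightarrow> (nat \<times> 's) \<times> ('l \<Rightarrow> int)) \<Rightarrow> mem \<Rightarrow> mem pmf" where
  "lift f m = return_pmf (if m \<in> enc ` configs then enc (f (inv_into configs enc m)) else m)"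

definition compile :: "('i, 'e update, 'o) stream_alg" where
  "compile = \<lparr>init = (\<lambda>i. map_pmf (\<lambda>s. enc (fresh 0 s)) (start i)), step = (\<lambda>u. lift (stepc u)),
     end_pass = lift endc, result = (\<lambda>m. out (snd (fst (inv_into configs enc m))))\<rparr>"

lemma fresh_in: "pc \<le> length prog \<Longrightarrow> s \<in> \<Sigma> \<Longrightarrow> fresh pc s \<in> configs"
  using M_pos by (auto simp: fresh_def configs_def)

lemma stepc_in: "c \<in> configs \<Longrightarrow> stepc u c \<in> configs"
  using M_pos by (cases c) (auto simp: configs_def)

lemma fold_stepc_in: "c \<in> configs \<Longrightarrow> fold stepc us c \<in> configs"
  by (induction us arbitrary: c) (simp_all add: stepc_in del: stepc.simps)

lemma endc_in: "c \<in> configs \<Longrightarrow> endc c \<in> configs"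
proof -
  assume c: "c \<in> configs"
  obtain pc s f where [simp]: "c = ((pc, s), f)" by (metis surj_pair)
  have "s \<in> \<Sigma>" using c by (auto simp: configs_def)
  then show ?thesis using c by (auto simp: Let_def intro!: fresh_in)
qed

lemma lift_enc: "c \<in> configs \<Longrightarrow> lift f (enc c) = return_pmf (enc (f c))"
  using enc(1) by (auto simp: lift_def)

lemma uses_space_compile: "uses_space compile b"
proof -
  have lift_len: "length m' = b" if "\<And>c. c \<in> configs \<Longrightarrow> f c \<in> configs" "length m = b" "m' \<in> set_pmf (lift f m)" for f m m'
    using that enc by (auto simp: lift_def inv_into_into split: if_splits)
  have "length m = b" if "m \<in> set_pmf (init compile i)" for i m
    using that start[of i] by (auto simp: compile_def intro!: enc(2) fresh_in)
  moreover have "length m' = b" if "length m = b" "m' \<in> set_pmf (step compile u m)" for u m m'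
    by (rule lift_len[of "stepc u", OF stepc_in that(1)]) (use that(2) in \<open>simp_all add: compile_def\<close>)
  moreover have "length m' = b" if "length m = b" "m' \<in> set_pmf (end_pass compile m)" for m m'
    by (rule lift_len[of endc, OF endc_in that(1)]) (use that(2) in \<open>simp_all add: compile_def\<close>)
  ultimately show ?thesis unfolding uses_space_def by blast
qed

lemma run_pass_compile:
  "c \<in> configs \<Longrightarrow> run_pass compile us (enc c) = return_pmf (enc (endc (fold stepc us c)))"
proof (induction us arbitrary: c)
  case Nil
  then show ?case by (simp add: compile_def lift_enc)
next
  case (Cons u us)
  have "step compile u (enc c) = return_pmf (enc (stepc u c))"
    using Cons.prems by (simp add: compile_def lift_enc)
  then show ?case using Cons by (simp add: bind_return_pmf stepc_in)
qed

lemma run_passes_compile: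
  "c \<in> configs \<Longrightarrow> run_passes compile us p (enc c) = return_pmf (enc (((endc \<circ> fold stepc us) ^^ p) c))"
proof (induction p arbitrary: c)
  case (Suc p)
  then show ?case
    by (simp add: run_pass_compile bind_return_pmf endc_in fold_stepc_in funpow_Suc_right
      del: funpow.simps endc.simps)
qed simp

text \<open>Reducing after every update amounts to one reduction of the integer sum, so wrapping
  around in the middle of a pass is harmless.\<close>

lemma fold_stepc:
  "fold stepc us ((pc, s), \<lambda>l\<in>live_labels pc s. a l mod int M) = ((pc, s), \<lambda>l\<in>live_labels pc s.
     (a l + (\<Sum>u\<leftarrow>us. update_sign u * of_bool (update_item u \<in> query (prog ! pc) s l))) mod int M)"
proof (induction us arbitrary: a)
  case (Cons u us)
  let ?x = "\<lambda>l. update_sign u * of_bool (update_item u \<in> query (prog ! pc) s l)"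
  have "stepc u ((pc, s), \<lambda>l\<in>live_labels pc s. a l mod int M) =
     ((pc, s), \<lambda>l\<in>live_labels pc s. (a l + ?x l) mod int M)"
    by (auto simp: mod_add_left_eq)
  then have "fold stepc (u # us) ((pc, s), \<lambda>l\<in>live_labels pc s. a l mod int M) =
     fold stepc us ((pc, s), \<lambda>l\<in>live_labels pc s. (a l + ?x l) mod int M)"
    by (simp only: fold_Cons o_apply)
  also note Cons.IH
  finally show ?case by (simp add: add.assoc)
qed simp

context
  fixes E :: "'e set" and us :: "'e update list"
  assumes E: "finite E" "card E < M" and us: "update_item ` set us \<subseteq> E" "\<And>e. net_mult us e \<in> {0, 1}"
begin

lemma fold_stepc_fresh:
  "fold stepc us (fresh pc s) = ((pc, s), \<lambda>l\<in>live_labels pc s. int (card (final_graph us \<inter> query (prog ! pc) s l)))"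
proof -
  have "card (final_graph us \<inter> X) < M" for X
    using E card_mono[of E "final_graph us \<inter> X"] final_graph_subset[OF us(1)] by (meson inf.coboundedI1 le_less_trans)
  then show ?thesis
    using fold_stepc[of us pc s "\<lambda>_. 0"] E(1) us by (simp add: fresh_def sum_list_updates)
qed

text \<open>Stated for the suffix \<open>p\<close> still to be executed, with the program counter at
  the length of the executed prefix, to let the induction over \<open>runs\<close> go
  through.\<close>

lemma funpow_compile:
  assumes "runs (final_graph us) \<Sigma> B p s s'" "prog = p0 @ p"
  shows "((endc \<circ> fold stepc us) ^^ length p) (fresh (length p0) s) = fresh (length prog) s'"
  using assms
proof (induction arbitrary: p0 rule: runs.induct)
  case (runs_Cons I s s' p s'')
  let ?pc = "length p0"
  have I: "prog ! ?pc = I" "?pc < length prog" using runs_Cons.prems by (auto simp: nth_append)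
  have lab: "live_labels ?pc s = labels I s" using runs_Cons.hyps I by (simp add: live_labels_def)
  have fin: "finite (final_graph us \<inter> X)" for X
    using E(1) final_graph_subset[OF us(1)] by (meson finite_Int finite_subset)
  have ans: "(\<lambda>l. l \<in> labels I s \<and> (\<lambda>l\<in>labels I s. int (card (final_graph us \<inter> query I s l))) l \<noteq> 0) =
     answer (final_graph us) I s"
    by (auto simp: answer_def fin fun_eq_iff)
  have "endc (fold stepc us (fresh ?pc s)) = fresh (Suc ?pc) s'"
    using I lab ans runs_Cons.hyps by (simp add: fold_stepc_fresh Let_def)
  moreover have "prog = (p0 @ [I]) @ p" using runs_Cons.prems by simp
  note IH = runs_Cons.IH[OF this]
  ultimately show ?case using IH by (simp add: funpow_Suc_right del: funpow.simps)
qed auto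

text \<open>After the draw of the start state everything is deterministic. Only an inequality holds,
  since a start state without such a trajectory may still lead to an output in
  \<open>X\<close>.\<close>

theorem compile_correct:
  "measure_pmf.prob (run_alg compile (length prog) i us) X \<ge>
   measure_pmf.prob (start i) {s. \<exists>s'. runs (final_graph us) \<Sigma> B prog s s' \<and> out s' \<in> X}"
proof -
  let ?F = "\<lambda>s. ((endc \<circ> fold stepc us) ^^ length prog) (fresh 0 s)"
  have F: "?F s \<in> configs" if "s \<in> \<Sigma>" for s
  proof -
    have "((endc \<circ> fold stepc us) ^^ p) (fresh 0 s) \<in> configs" for p
      by (induction p) (auto intro!: fresh_in that fold_stepc_in endc_in simp del: endc.simps)
    then show ?thesis .
  qed
  have "run_alg compile (length prog) i us =
     map_pmf (result compile) (bind_pmf (start i) (\<lambda>s. run_passes compile us (length prog) (enc (fresh 0 s))))"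
    by (simp add: run_alg_def compile_def bind_map_pmf)
  also have "\<dots> = map_pmf (result compile) (bind_pmf (start i) (\<lambda>s. return_pmf (enc (?F s))))"
    using start[of i] by (intro arg_cong[of _ _ "map_pmf _"] bind_pmf_cong refl run_passes_compile fresh_in) auto
  also have "\<dots> = map_pmf (\<lambda>s. out (snd (fst (?F s)))) (start i)"
    unfolding map_bind_pmf map_return_pmf map_pmf_def[of _ "start i"]
    using start[of i] F enc(1) by (intro bind_pmf_cong refl) (auto simp: compile_def)
  finally have run: "run_alg compile (length prog) i us = map_pmf (\<lambda>s. out (snd (fst (?F s)))) (start i)" .
  have "{s. \<exists>s'. runs (final_graph us) \<Sigma> B prog s s' \<and> out s' \<in> X} \<subseteq> (\<lambda>s. out (snd (fst (?F s)))) -` X"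
  proof safe
    fix s s' assume "runs (final_graph us) \<Sigma> B prog s s'" "out s' \<in> X"
    then show "s \<in> (\<lambda>s. out (snd (fst (?F s)))) -` X"
      using funpow_compile[of prog s s' "[]"] by (simp add: fresh_def)
  qed
  then show ?thesis unfolding run measure_map_pmf
    by (intro measure_pmf.finite_measure_mono) auto
qed

end

end

section \<open>Delayed searches from hubs\<close>

record bfs_state =
  hub :: "nat \<Rightarrow> nat"
  delay :: "nat \<Rightarrow> nat"
  prev_layer :: "(nat \<times> nat) set"
  cur_layer :: "(nat \<times> nat) set"
  cand :: "(nat \<times> nat) set"
  hub_dist :: "nat \<times> nat \<Rightarrow> enat"
  src_dist :: "nat \<times> nat \<Rightarrow> enat"
  parent :: "nat \<times> nat \<Rightarrow> nat"

type_synonym bfs_instr = "(bfs_state, nat \<times> nat, nat set) pass_instr"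

text \<open>One instruction is one whole pass, so a computation that ignores the stream is charged a
  pass too.\<close>

definition local_pass :: "(bfs_state \<Rightarrow> bfs_state) \<Rightarrow> bfs_instr" where
  "local_pass f = Pass (\<lambda>_. {}) (\<lambda>_ _. {}) (\<lambda>s _. f s)"

lemma runs_local_pass:
  "f s \<in> \<Sigma> \<Longrightarrow> runs G \<Sigma> B p (f s) s' \<Longrightarrow> runs G \<Sigma> B (local_pass f # p) s s'"
  by (rule runs_Cons) (auto simp: local_pass_def)

text \<open>Shortest-path distances in the weighted graph \<open>w\<close>, as the largest feasible potential.\<close>

definition potential_dist :: "nat \<Rightarrow> (nat \<times> nat \<Rightarrow> enat) \<Rightarrow> nat \<Rightarrow> nat \<Rightarrow> enat" where
  "potential_dist K w i j = Sup {g j | g. g i = 0 \<and> (\<forall>a<K. \<forall>b<K. g b \<le> g a + w (a, b))}"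

lemma potential_dist_self: "potential_dist K w i i = 0"
proof -
  have "{g i | g. g i = 0 \<and> (\<forall>a<K. \<forall>b<K. g b \<le> g a + w (a, b))} = {0}"
    by (auto intro!: exI[of _ "\<lambda>_. 0"])
  then show ?thesis by (simp add: potential_dist_def)
qed

lemma potential_dist_step:
  assumes "a < K" "b < K" shows "potential_dist K w i b \<le> potential_dist K w i a + w (a, b)"
  unfolding potential_dist_def[of K w i b]
proof (rule Sup_least)
  fix x assume "x \<in> {g b | g. g i = 0 \<and> (\<forall>a<K. \<forall>b<K. g b \<le> g a + w (a, b))}"
  then obtain g where g: "x = g b" "g i = 0" "\<forall>a<K. \<forall>b<K. g b \<le> g a + w (a, b)" by blast
  then have "g a \<le> potential_dist K w i a"
    unfolding potential_dist_def by (blast intro: Sup_upper)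
  moreover have "g b \<le> g a + w (a, b)" using g assms by blast
  ultimately show "x \<le> potential_dist K w i a + w (a, b)"
    unfolding g(1) by (meson add_right_mono order_trans)
qed

lemma potential_dist_ge:
  assumes "g i = 0" "\<And>a b. a < K \<Longrightarrow> b < K \<Longrightarrow> g b \<le> g a + w (a, b)"
  shows "g j \<le> potential_dist K w i j"
  unfolding potential_dist_def using assms by (blast intro: Sup_upper)

text \<open>
  \<open>K\<close> hubs, the first \<open>c\<close> of which are the sources; \<open>T\<close> time steps per sweep, \<open>q\<close> rounds per
  bisection, and at most \<open>cap\<close> pairs in a layer. A pair \<open>(i, v)\<close> is in the layer of time \<open>t\<close> if the
  search from hub \<open>i\<close>, which starts at time \<open>delay i\<close>, reaches \<open>v\<close> at time \<open>t\<close>.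
\<close>

locale hub_bfs =
  fixes n c K q \<Delta> T cap :: nat
begin

definition small_sets :: "(nat \<times> nat) set set" where
  "small_sets = {A. A \<subseteq> {..<2 ^ q} \<times> {..<n} \<and> card A \<le> cap}"

text \<open>The bound \<open>2 * n\<close> is for \<open>src_dist\<close>, whose finite entries are
  sums of two distances below \<open>n\<close>.\<close>

definition lengths :: "enat set" where
  "lengths = insert \<infinity> (enat ` {..2 * n})"

definition states :: "bfs_state set" where
  "states = {s. hub s \<in> {..<K} \<rightarrow>\<^sub>E {..<n} \<and> delay s \<in> {..<K} \<rightarrow>\<^sub>E {..<\<Delta>} \<and>
     prev_layer s \<in> small_sets \<and> cur_layer s \<in> small_sets \<and> cand s \<in> small_sets \<and>
     hub_dist s \<in> {..<K} \<times> {..<K} \<rightarrow>\<^sub>E lengths \<and> src_dist s \<in> {..<c} \<times> {..<n} \<rightarrow>\<^sub>E lengths \<and>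
     parent s \<in> {..<c} \<times> {..<n} \<rightarrow>\<^sub>E {..<2 ^ q}}"

text \<open>
  Candidates are pairs \<open>(a, v)\<close>, where \<open>a\<close> is a binary prefix of the index of a hub whose search may
  reach \<open>v\<close> in the next step.
\<close>

definition bisect_pass :: "nat \<Rightarrow> bfs_instr" where
  "bisect_pass e = Pass (\<lambda>s. {(a, v). (a div 2, v) \<in> cand s})
     (\<lambda>s (a, v). {{u, v} | u i. i div 2 ^ e = a \<and> (i, u) \<in> cur_layer s \<and>
        (i, v) \<notin> cur_layer s \<and> (i, v) \<notin> prev_layer s})
     (\<lambda>s ans. s\<lparr>cand := {x. ans x}\<rparr>)"

primrec bisect :: "nat \<Rightarrow> bfs_instr list" where
  "bisect 0 = []"
| "bisect (Suc e) = bisect_pass e # bisect e"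

text \<open>The time \<open>t\<close> is built into the instruction and thus found through the
  program counter; the state has no field for it. \<open>0\<close> is the empty prefix, so every
  vertex starts as a candidate.\<close>

definition begin_layer :: "(nat \<Rightarrow> bfs_state \<Rightarrow> bfs_state) \<Rightarrow> nat \<Rightarrow> bfs_instr" where
  "begin_layer U t = local_pass (\<lambda>s. (U t s)\<lparr>cand := {0} \<times> {..<n}\<rparr>)"

definition end_layer :: "nat \<Rightarrow> bfs_instr" where
  "end_layer t = local_pass (\<lambda>s. s\<lparr>prev_layer := cur_layer s,
     cur_layer := cand s \<union> {(i, hub s i) | i. i < K \<and> delay s i = Suc t}\<rparr>)"

definition start_sweep :: bfs_instr where
  "start_sweep = local_pass (\<lambda>s. s\<lparr>prev_layer := {},
     cur_layer := {(i, hub s i) | i. i < K \<and> delay s i = 0}\<rparr>)"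

definition layer :: "(nat \<Rightarrow> bfs_state \<Rightarrow> bfs_state) \<Rightarrow> nat \<Rightarrow> bfs_instr list" where
  "layer U t = begin_layer U t # bisect q @ [end_layer t]"

definition sweep :: "(nat \<Rightarrow> bfs_state \<Rightarrow> bfs_state) \<Rightarrow> bfs_instr list" where
  "sweep U = start_sweep # concat (map (layer U) [0..<T])"

definition record_hub_dist :: "nat \<Rightarrow> bfs_state \<Rightarrow> bfs_state" where
  "record_hub_dist t s = s\<lparr>hub_dist := \<lambda>(i, j)\<in>{..<K} \<times> {..<K}.
     if (i, hub s j) \<in> cur_layer s then enat (t - delay s i) else hub_dist s (i, j)\<rparr>"

text \<open>The distance from hub \<open>j\<close> to \<open>v\<close> is available only while
  \<open>(j, v)\<close> is in the current layer, hence the running minimum. The distances from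
  sources to hubs are recomputed from \<open>hub_dist\<close> and never stored.\<close>

definition record_src_dist :: "nat \<Rightarrow> bfs_state \<Rightarrow> bfs_state" where
  "record_src_dist t s = s\<lparr>src_dist := \<lambda>(i, v)\<in>{..<c} \<times> {..<n}. min (src_dist s (i, v))
     (INF j \<in> {j. (j, v) \<in> cur_layer s}. potential_dist K (hub_dist s) i j + enat (t - delay s j))\<rparr>"

text \<open>\<open>parent\<close> holds the leading bits found so far. The query asks whether some
  parent continues them with bit \<open>0\<close>; if none does, bit \<open>1\<close> is
  appended.\<close>

definition parent_pass :: "nat \<Rightarrow> bfs_instr" where
  "parent_pass e = Pass (\<lambda>s. {..<c} \<times> {..<n})
     (\<lambda>s (i, v). {{u, v} | u. u < n \<and> src_dist s (i, u) + 1 = src_dist s (i, v) \<and>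
        u div 2 ^ e = 2 * parent s (i, v)})
     (\<lambda>s ans. s\<lparr>parent := \<lambda>x\<in>{..<c} \<times> {..<n}. 2 * parent s x + of_bool (\<not> ans x)\<rparr>)"

primrec find_parents :: "nat \<Rightarrow> bfs_instr list" where
  "find_parents 0 = []"
| "find_parents (Suc e) = parent_pass e # find_parents e"

definition program :: "bfs_instr list" where
  "program = sweep record_hub_dist @ sweep record_src_dist @ find_parents q"

definition initial :: "(nat \<Rightarrow> nat) \<Rightarrow> (nat \<Rightarrow> nat) \<Rightarrow> bfs_state" where
  "initial h d = \<lparr>hub = h, delay = d, prev_layer = {}, cur_layer = {}, cand = {},
     hub_dist = \<lambda>x\<in>{..<K} \<times> {..<K}. \<infinity>, src_dist = \<lambda>x\<in>{..<c} \<times> {..<n}. \<infinity>,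
     parent = \<lambda>x\<in>{..<c} \<times> {..<n}. 0\<rparr>"

definition trees :: "bfs_state \<Rightarrow> nat \<Rightarrow> nat set set" where
  "trees s r = (let i = (SOME i. i < c \<and> hub s i = r) in
     {{parent s (i, v), v} | v. v < n \<and> src_dist s (i, v) \<noteq> \<infinity> \<and> v \<noteq> r})"

lemma length_program: "length program = 2 * (T * (q + 2) + 1) + q"
proof -
  have "length (bisect e) = e" "length (find_parents e) = e" for e by (induction e) auto
  then have "length (sweep U) = T * (q + 2) + 1" for U
    by (simp add: sweep_def layer_def length_concat o_def sum_list_triv)
  then show ?thesis by (simp add: program_def \<open>\<And>e. length (find_parents e) = e\<close>)
qed

lemma initial_in_states:
  "h \<in> {..<K} \<rightarrow>\<^sub>E {..<n} \<Longrightarrow> d \<in> {..<K} \<rightarrow>\<^sub>E {..<\<Delta>} \<Longrightarrow> initial h d \<in> states"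
  by (auto simp: states_def initial_def small_sets_def lengths_def)

end

text \<open>\<open>hit\<close> and \<open>load\<close> are all that is needed from the random
  choices. In \<open>hit\<close> the hub must differ from \<open>u\<close>, which may be a hub
  itself, so that a chain of hubs advances. \<open>\<Delta> + l \<le> T\<close> lets every search
  reach radius \<open>l\<close> within the sweep, and \<open>2 * cap \<le> B\<close> pays for two
  children of each candidate.\<close>

locale good_hubs = hub_bfs +
  fixes G :: "nat set set" and h \<delta> :: "nat \<Rightarrow> nat" and l B :: nat
  assumes G: "G \<subseteq> all_edges n"
    and h: "h \<in> {..<K} \<rightarrow>\<^sub>E {..<n}" and \<delta>: "\<delta> \<in> {..<K} \<rightarrow>\<^sub>E {..<\<Delta>}"
    and c_le: "c \<le> K" and K_le: "K \<le> 2 ^ q" and n_le: "n \<le> 2 ^ q" and q_pos: "0 < q" and T: "\<Delta> + l \<le> T"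
    and n_cap: "n \<le> cap" and B: "2 * cap \<le> B" "c * n \<le> B"
    and hit: "\<And>u v. u < n \<Longrightarrow> v < n \<Longrightarrow> graph_dist G u v = enat l \<Longrightarrow>
       \<exists>j<K. h j \<noteq> u \<and> graph_dist G u (h j) + graph_dist G (h j) v = enat l"
    and load: "\<And>t. t \<le> T \<Longrightarrow>
       card {(i, v). i < K \<and> v < n \<and> graph_dist G (h i) v + enat (\<delta> i) = enat t} \<le> cap"
begin

abbreviation "d i v \<equiv> graph_dist G (h i) v"

section \<open>Layers of the delayed searches\<close>

definition Layer :: "nat \<Rightarrow> (nat \<times> nat) set" where
  "Layer t = {(i, v). i < K \<and> v < n \<and> (\<exists>a. d i v = enat a \<and> a + \<delta> i = t)}"

text \<open>The shift by \<open>Suc\<close> makes this empty at time \<open>0\<close>, where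
  \<open>Layer (t - 1)\<close> would repeat the layer.\<close>

definition Prev :: "nat \<Rightarrow> (nat \<times> nat) set" where
  "Prev t = {(i, v). i < K \<and> v < n \<and> (\<exists>a. d i v = enat a \<and> Suc (a + \<delta> i) = t)}"

definition New :: "nat \<Rightarrow> (nat \<times> nat) set" where
  "New t = {(i, v). v < n \<and> (\<exists>u. (i, u) \<in> Layer t \<and> {u, v} \<in> G \<and> (i, v) \<notin> Layer t \<and> (i, v) \<notin> Prev t)}"

abbreviation mk where
  "mk F' F C X Y P \<equiv> \<lparr>hub = h, delay = \<delta>, prev_layer = F', cur_layer = F, cand = C,
     hub_dist = X, src_dist = Y, parent = P\<rparr>"

definition valid_tables where
  "valid_tables X Y P \<longleftrightarrow> X \<in> {..<K} \<times> {..<K} \<rightarrow>\<^sub>E lengths \<and> Y \<in> {..<c} \<times> {..<n} \<rightarrow>\<^sub>E lengths \<and>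
     P \<in> {..<c} \<times> {..<n} \<rightarrow>\<^sub>E {..<2 ^ q}"

lemma mk_in_states:
  "F' \<in> small_sets \<Longrightarrow> F \<in> small_sets \<Longrightarrow> C \<in> small_sets \<Longrightarrow> valid_tables X Y P \<Longrightarrow> mk F' F C X Y P \<in> states"
  using h \<delta> by (simp add: states_def valid_tables_def)

lemma h_less: "i < K \<Longrightarrow> h i < n"
  using h by auto

lemma Prev_0: "Prev 0 = {}" and Prev_Suc: "Prev (Suc t) = Layer t"
  by (auto simp: Prev_def Layer_def)

lemma Layer_0: "Layer 0 = {(i, h i) | i. i < K \<and> \<delta> i = 0}"
proof -
  have "d i v = enat 0 \<longleftrightarrow> v = h i" for i v
    by (metis graph_dist_eq_0_iff zero_enat_def)
  then show ?thesis by (auto simp: Layer_def h_less)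
qed

text \<open>An edge changes the distance from a hub by at most one. So a neighbour of the current
  layer lies in the previous, the current or the next one, and no record of older layers is needed
  to recognize new vertices.\<close>

lemma Layer_Suc: "Layer (Suc t) = New t \<union> {(i, h i) | i. i < K \<and> \<delta> i = Suc t}"
proof (intro equalityI subsetI)
  fix x assume "x \<in> Layer (Suc t)"
  then obtain i v a where x: "x = (i, v)" "i < K" "v < n" "d i v = enat a" "a + \<delta> i = Suc t"
    by (auto simp: Layer_def)
  show "x \<in> New t \<union> {(i, h i) | i. i < K \<and> \<delta> i = Suc t}"
  proof (cases a)
    case 0
    then have "v = h i" using x by (metis graph_dist_eq_0_iff zero_enat_def)
    then show ?thesis using x 0 by auto
  next
    case (Suc b)
    then obtain u where u: "{u, v} \<in> G" "d i u = enat b"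
      using x graph_dist_pred[of G "h i" v b] by auto
    moreover have "u < n" using finite_graph_dist_imp_less[OF G h_less u(2)] x by blast
    ultimately have "(i, u) \<in> Layer t" using x Suc by (auto simp: Layer_def)
    moreover have "(i, v) \<notin> Layer t" "(i, v) \<notin> Prev t" using x by (auto simp: Layer_def Prev_def)
    ultimately show ?thesis using x u by (auto simp: New_def)
  qed
next
  fix x assume "x \<in> New t \<union> {(i, h i) | i. i < K \<and> \<delta> i = Suc t}"
  then consider i where "x = (i, h i)" "i < K" "\<delta> i = Suc t" | "x \<in> New t" by blast
  then show "x \<in> Layer (Suc t)"
  proof cases
    case 1
    then show ?thesis using h_less by (auto simp: Layer_def zero_enat_def)
  next
    case 2
    then obtain i u v where x: "x = (i, v)" "v < n" "(i, u) \<in> Layer t" "{u, v} \<in> G"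
      "(i, v) \<notin> Layer t" "(i, v) \<notin> Prev t" by (auto simp: New_def)
    obtain a where a: "d i u = enat a" "a + \<delta> i = t" "i < K" using x by (auto simp: Layer_def)
    have le: "d i v \<le> d i u + 1" "d i u \<le> d i v + 1"
      using graph_dist_edge[of u v G] graph_dist_edge[of v u G] x(4) by (auto simp: insert_commute)
    then obtain b where b: "d i v = enat b" using a by (cases "d i v") (auto simp: one_enat_def)
    have "b \<le> Suc a" "a \<le> Suc b" using le a b by (auto simp: one_enat_def)
    moreover have "b + \<delta> i \<noteq> t" "Suc (b + \<delta> i) \<noteq> t" using x b a by (auto simp: Layer_def Prev_def)
    ultimately have "b + \<delta> i = Suc t" using a by linarith
    then show ?thesis using x a b by (auto simp: Layer_def)
  qed
qed

lemma Layer_small: "t \<le> T \<Longrightarrow> Layer t \<in> small_sets"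
proof -
  assume t: "t \<le> T"
  have "d i v + enat (\<delta> i) = enat t \<longleftrightarrow> (\<exists>a. d i v = enat a \<and> a + \<delta> i = t)" for i v
    by (cases "d i v") auto
  then have "card (Layer t) \<le> cap" using load[OF t] by (simp add: Layer_def)
  then show ?thesis using K_le by (auto simp: small_sets_def Layer_def)
qed

lemma finite_small: "A \<in> small_sets \<Longrightarrow> finite A"
  by (auto simp: small_sets_def intro: finite_subset)

lemma small_subset: "A \<in> small_sets \<Longrightarrow> A' \<subseteq> A \<Longrightarrow> A' \<in> small_sets"
proof -
  assume A: "A \<in> small_sets" "A' \<subseteq> A"
  have "card A' \<le> card A" by (rule card_mono[OF finite_small[OF A(1)] A(2)])
  with A show ?thesis by (auto simp: small_sets_def)
qed

lemma Prev_small: "t \<le> T \<Longrightarrow> Prev t \<in> small_sets"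
  by (cases t) (auto simp: Prev_0 Prev_Suc intro: Layer_small, simp add: small_sets_def)

lemma New_small: "t < T \<Longrightarrow> New t \<in> small_sets"
  using small_subset[OF Layer_small[of "Suc t"]] Layer_Suc by auto

lemma New_less: "(i, v) \<in> New t \<Longrightarrow> i < K \<and> v < n"
  by (auto simp: New_def Layer_def)

text \<open>\<open>e\<close> counts the undetermined bits. The incoming \<open>C\<close> need only
  cover the prefixes of the next layer, since one pass makes the candidates exact; for
  \<open>e = 0\<close> no pass remains, and \<open>C\<close> must be exact already.\<close>

lemma runs_bisect:
  assumes t: "t < T" and tab: "valid_tables X Y P"
  shows "e \<le> q \<Longrightarrow> C \<in> small_sets \<Longrightarrow> (\<lambda>(i, v). (i div 2 ^ e, v)) ` New t \<subseteq> C \<Longrightarrow>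
    (e = 0 \<Longrightarrow> C = New t) \<Longrightarrow>
    runs G states B (bisect e) (mk (Prev t) (Layer t) C X Y P) (mk (Prev t) (Layer t) (New t) X Y P)"
proof (induction e arbitrary: C)
  case 0
  then show ?case by (simp add: runs_Nil)
next
  case (Suc e)
  let ?s = "mk (Prev t) (Layer t) C X Y P"
  define D where "D = (\<lambda>(i, v). (i div 2 ^ e, v)) ` New t"
  \<comment> \<open>A label is a candidate prefix extended by one bit, which gives at most
    \<open>2 * cap\<close> counters.\<close>
  have sub: "labels (bisect_pass e) ?s \<subseteq> (\<lambda>((a, v), b). (2 * a + b, v)) ` (C \<times> {0, 1})"
  proof
    fix x assume "x \<in> labels (bisect_pass e) ?s"
    then obtain a v where x: "x = (a, v)" "(a div 2, v) \<in> C" by (auto simp: bisect_pass_def)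
    have "a mod 2 \<in> {0, 1}" by auto
    with x show "x \<in> (\<lambda>((a, v), b). (2 * a + b, v)) ` (C \<times> {0, 1})"
      by (intro image_eqI[of _ _ "((a div 2, v), a mod 2)"]) auto
  qed
  have finC: "finite C" using Suc.prems finite_small by blast
  then have fin: "finite (labels (bisect_pass e) ?s)" by (intro finite_subset[OF sub]) auto
  have "card (labels (bisect_pass e) ?s) \<le> card (C \<times> {0 :: nat, 1})"
    using finC by (intro surj_card_le[OF _ sub]) auto
  also have "\<dots> \<le> B" using Suc.prems B by (simp add: card_cartesian_product small_sets_def)
  finally have card: "card (labels (bisect_pass e) ?s) \<le> B" .
  have "answer G (bisect_pass e) ?s (a, v) \<longleftrightarrow> (a, v) \<in> D" for a v
  proof
    assume "answer G (bisect_pass e) ?s (a, v)"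
    then obtain u i where "(a div 2, v) \<in> C" "{u, v} \<in> G" "i div 2 ^ e = a" "(i, u) \<in> Layer t"
        "(i, v) \<notin> Layer t" "(i, v) \<notin> Prev t"
      by (auto simp: answer_def bisect_pass_def)
    moreover from this have "v < n" using Suc.prems(2) by (auto simp: small_sets_def)
    ultimately have "(i, v) \<in> New t" "a = i div 2 ^ e" by (auto simp: New_def)
    then show "(a, v) \<in> D" by (auto simp: D_def)
  next
    assume "(a, v) \<in> D"
    then obtain i where i: "a = i div 2 ^ e" "(i, v) \<in> New t" by (auto simp: D_def)
    then have "a div 2 = i div 2 ^ Suc e" by (simp only: power_Suc2 div_mult2_eq)
    then have "(a div 2, v) \<in> C" using Suc.prems(3) i by force
    moreover have "G \<inter> query (bisect_pass e) ?s (a, v) \<noteq> {}"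
      using i by (auto simp: New_def bisect_pass_def)
    ultimately show "answer G (bisect_pass e) ?s (a, v)"
      by (auto simp: answer_def bisect_pass_def)
  qed
  then have upd: "update (bisect_pass e) ?s (answer G (bisect_pass e) ?s) = mk (Prev t) (Layer t) D X Y P"
    by (auto simp: bisect_pass_def)
  \<comment> \<open>The surviving prefixes are an image of \<open>New t\<close>, so they are never
    more numerous than the next layer.\<close>
  have "card D \<le> card (New t)" unfolding D_def
    using finite_small[OF New_small[OF t]] by (rule card_image_le)
  moreover have "D \<subseteq> {..<2 ^ q} \<times> {..<n}"
  proof
    fix x assume "x \<in> D"
    then obtain i v where i: "x = (i div 2 ^ e, v)" "(i, v) \<in> New t" by (auto simp: D_def)
    have "i div 2 ^ e \<le> i" by simp
    also have "i < 2 ^ q" using New_less[OF i(2)] K_le by simp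
    finally show "x \<in> {..<2 ^ q} \<times> {..<n}" using i New_less[OF i(2)] by simp
  qed
  ultimately have D: "D \<in> small_sets" using New_small[OF t] by (simp add: small_sets_def)
  have st: "mk (Prev t) (Layer t) D X Y P \<in> states"
    using t tab D by (intro mk_in_states Prev_small Layer_small) auto
  have "e = 0 \<Longrightarrow> D = New t" by (auto simp: D_def)
  then have "runs G states B (bisect e) (mk (Prev t) (Layer t) D X Y P) (mk (Prev t) (Layer t) (New t) X Y P)"
    using Suc.IH[OF _ D] Suc.prems(1) unfolding D_def by simp
  then show ?case unfolding bisect.simps by (rule runs_Cons[OF fin card upd st])
qed

lemma runs_layer:
  assumes t: "t < T" and tab: "valid_tables X' Y' P"
    and U: "U t (mk (Prev t) (Layer t) C X Y P) = mk (Prev t) (Layer t) C X' Y' P"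
  shows "runs G states B (layer U t) (mk (Prev t) (Layer t) C X Y P)
    (mk (Prev (Suc t)) (Layer (Suc t)) (New t) X' Y' P)"
proof -
  have C: "{0} \<times> {..<n} \<in> small_sets"
    using n_cap by (auto simp: small_sets_def card_cartesian_product)
  have sub: "(\<lambda>(i, v). (i div 2 ^ q, v)) ` New t \<subseteq> {0} \<times> {..<n}"
    using New_less K_le by fastforce
  \<comment> \<open>\<open>q_pos\<close> voids the exactness condition for \<open>e = 0\<close>,
    which the full set of candidates need not satisfy.\<close>
  have b: "runs G states B (bisect q) (mk (Prev t) (Layer t) ({0} \<times> {..<n}) X' Y' P)
     (mk (Prev t) (Layer t) (New t) X' Y' P)"
    using q_pos by (intro runs_bisect[OF t tab order_refl C sub]) auto
  have e: "runs G states B [end_layer t] (mk (Prev t) (Layer t) (New t) X' Y' P)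
     (mk (Prev (Suc t)) (Layer (Suc t)) (New t) X' Y' P)"
    unfolding end_layer_def using t tab
    by (intro runs_local_pass)
       (auto simp: Prev_Suc Layer_Suc[symmetric] intro!: runs_Nil mk_in_states Layer_small New_small)
  show ?thesis
    unfolding layer_def begin_layer_def using t tab U runs_append[OF b e] C
    by (intro runs_local_pass) (auto intro!: mk_in_states Prev_small Layer_small)
qed

lemma runs_sweep:
  assumes tab: "\<And>t. t \<le> T \<Longrightarrow> valid_tables (X t) (Y t) P" and C: "C \<in> small_sets"
    and U: "\<And>t C. t < T \<Longrightarrow> U t (mk (Prev t) (Layer t) C (X t) (Y t) P) =
       mk (Prev t) (Layer t) C (X (Suc t)) (Y (Suc t)) P"
  shows "\<exists>F'\<in>small_sets. \<exists>F\<in>small_sets. \<exists>C'\<in>small_sets.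
    runs G states B (sweep U) (mk A A' C (X 0) (Y 0) P) (mk F' F C' (X T) (Y T) P)"
proof -
  have "t \<le> T \<Longrightarrow> \<exists>C'\<in>small_sets. runs G states B (concat (map (layer U) [0..<t]))
      (mk (Prev 0) (Layer 0) C (X 0) (Y 0) P) (mk (Prev t) (Layer t) C' (X t) (Y t) P)" for t
  proof (induction t)
    case 0
    then show ?case using C by (auto intro: runs_Nil)
  next
    case (Suc t)
    then obtain C' where "runs G states B (concat (map (layer U) [0..<t]))
      (mk (Prev 0) (Layer 0) C (X 0) (Y 0) P) (mk (Prev t) (Layer t) C' (X t) (Y t) P)" by auto
    moreover have "runs G states B (layer U t) (mk (Prev t) (Layer t) C' (X t) (Y t) P)
      (mk (Prev (Suc t)) (Layer (Suc t)) (New t) (X (Suc t)) (Y (Suc t)) P)"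
      using Suc.prems by (intro runs_layer tab U) auto
    ultimately have "runs G states B (concat (map (layer U) [0..<t]) @ layer U t)
      (mk (Prev 0) (Layer 0) C (X 0) (Y 0) P)
      (mk (Prev (Suc t)) (Layer (Suc t)) (New t) (X (Suc t)) (Y (Suc t)) P)"
      by (rule runs_append)
    then show ?case using New_small[of t] Suc.prems by (intro bexI[of _ "New t"]) auto
  qed
  then obtain C' where C': "C' \<in> small_sets" "runs G states B (concat (map (layer U) [0..<T]))
      (mk (Prev 0) (Layer 0) C (X 0) (Y 0) P) (mk (Prev T) (Layer T) C' (X T) (Y T) P)" by auto
  have "mk (Prev 0) (Layer 0) C (X 0) (Y 0) P \<in> states"
    using C tab by (intro mk_in_states Prev_small Layer_small) auto
  then have "runs G states B (sweep U) (mk A A' C (X 0) (Y 0) P) (mk (Prev T) (Layer T) C' (X T) (Y T) P)"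
    unfolding sweep_def start_sweep_def using C'(2)
    by (intro runs_local_pass) (simp_all add: Prev_0 Layer_0)
  then show ?thesis using C'(1) Prev_small[of T] Layer_small[of T] by blast
qed

section \<open>Distances collected by the two sweeps\<close>

definition hub_table :: "nat \<Rightarrow> nat \<times> nat \<Rightarrow> enat" where
  "hub_table t = (\<lambda>(i, j)\<in>{..<K} \<times> {..<K}. if \<exists>a. d i (h j) = enat a \<and> a + \<delta> i < t then d i (h j) else \<infinity>)"

text \<open>The contents once all times below \<open>t\<close> are recorded, with the true distances
  in place of \<open>potential_dist\<close>.\<close>

definition src_table :: "nat \<Rightarrow> nat \<times> nat \<Rightarrow> enat" where
  "src_table t = (\<lambda>(i, v)\<in>{..<c} \<times> {..<n}.
     INF j \<in> {j. j < K \<and> (\<exists>a. d j v = enat a \<and> a + \<delta> j < t)}. d i (h j) + d j v)"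

lemma dist_in_lengths: "i < K \<Longrightarrow> d i v \<in> lengths"
  using graph_dist_less[OF G h_less, of i v] by (cases "d i v") (fastforce simp: lengths_def)+

lemma hub_table_valid: "hub_table t \<in> {..<K} \<times> {..<K} \<rightarrow>\<^sub>E lengths"
  by (auto simp: hub_table_def dist_in_lengths) (auto simp: lengths_def)

lemma hub_table_0: "hub_table 0 = (\<lambda>x\<in>{..<K} \<times> {..<K}. \<infinity>)"
  by (auto simp: hub_table_def fun_eq_iff)

lemma record_hub_dist_mk:
  "record_hub_dist t (mk (Prev t) (Layer t) C (hub_table t) Y P) =
   mk (Prev t) (Layer t) C (hub_table (Suc t)) Y P"
proof -
  have "(if (i, h j) \<in> Layer t then enat (t - \<delta> i) else hub_table t (i, j)) = hub_table (Suc t) (i, j)"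
    if "i < K" "j < K" for i j
    using that by (cases "d i (h j)") (auto simp: hub_table_def Layer_def h_less less_Suc_eq)
  then have "(\<lambda>(i, j)\<in>{..<K} \<times> {..<K}. if (i, h j) \<in> Layer t then enat (t - \<delta> i) else hub_table t (i, j)) =
     hub_table (Suc t)"
    by (auto simp: fun_eq_iff hub_table_def)
  then show ?thesis by (simp add: record_hub_dist_def cong: if_cong)
qed

text \<open>Delays are below \<open>\<Delta>\<close>, so a target within distance \<open>l\<close>
  is met strictly before \<open>\<Delta> + l\<close>, and the sweep records all times below
  \<open>T\<close>.\<close>

lemma hub_table_eq:
  assumes "i < K" "j < K" "d i (h j) \<le> enat l"
  shows "hub_table T (i, j) = d i (h j)"
proof -
  obtain a where a: "d i (h j) = enat a" "a \<le> l" using assms(3) by (cases "d i (h j)") auto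
  have "\<delta> i < \<Delta>" using \<delta> assms by auto
  then have "a + \<delta> i < T" using a T by linarith
  with a assms show ?thesis by (auto simp: hub_table_def)
qed

text \<open>A hub on a geodesic to \<open>v\<close> that is nearest to \<open>v\<close> is at distance less than \<open>l\<close>: otherwise a hub
  hits the first \<open>l\<close> steps from it towards \<open>v\<close>.\<close>

lemma last_hub:
  assumes i: "i < K" and fin: "d i v = enat x"
  shows "\<exists>j<K. potential_dist K (hub_table T) i j + d j v \<le> d i v \<and> d j v < enat l"
proof -
  let ?E = "potential_dist K (hub_table T) i"
  have "\<exists>j<K. ?E j + d j v \<le> d i v \<and> d j v < enat l"
    if "j < K" "?E j + d j v \<le> d i v" "d j v = enat a" for j a
    using that
  proof (induction a arbitrary: j rule: less_induct)
    case (less a)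
    show ?case
    proof (cases "a < l")
      case True
      then show ?thesis using less.prems by auto
    next
      case False
      then have "d j v = enat (l + (a - l))" using less.prems by simp
      then obtain w where w: "d j w = enat l" "graph_dist G w v = enat (a - l)"
        by (rule graph_dist_split)
      have "w < n" using finite_graph_dist_imp_less[OF G h_less w(1)] less.prems by blast
      then obtain j' where j': "j' < K" "h j' \<noteq> h j" "d j (h j') + d j' w = enat l"
        using hit[OF h_less[OF less.prems(1)] _ w(1)] by blast
      then obtain b b' where b: "d j (h j') = enat b" "d j' w = enat b'" "b + b' = l"
        by (cases "d j (h j')"; cases "d j' w") auto
      \<comment> \<open>Strict progress of the chain of hubs, due to the inequality in
        \<open>hit\<close>.\<close>
      have "b \<noteq> 0" using b(1) j'(2) by (metis graph_dist_eq_0_iff zero_enat_def)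
      have "d j' v \<le> enat (b' + (a - l))"
        using graph_dist_triangle[of G "h j'" v w] w b by simp
      then obtain a' where a': "d j' v = enat a'" "a' \<le> b' + (a - l)" by (cases "d j' v") auto
      have "hub_table T (j, j') = enat b"
        using hub_table_eq[of j j'] less.prems(1) j'(1) b by auto
      then have "?E j' \<le> ?E j + enat b"
        using potential_dist_step[OF less.prems(1) j'(1), of "hub_table T" i] by simp
      then have "?E j' + d j' v \<le> ?E j + enat b + enat a'"
        unfolding a'(1) by (rule add_right_mono)
      also have "\<dots> \<le> ?E j + enat a" using a' b False by (cases "?E j") auto
      also have "\<dots> \<le> d i v" using less.prems by simp
      finally have le: "?E j' + d j' v \<le> d i v" .
      have "a' < a" using a' b \<open>b \<noteq> 0\<close> False by linarith
      from less.IH[OF this j'(1) le a'(1)] show ?thesis .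
    qed
  qed
  \<comment> \<open>The chain starts at hub \<open>i\<close> itself, whose potential is
    \<open>0\<close>.\<close>
  from this[of i x] show ?thesis using i fin by (simp add: potential_dist_self)
qed

text \<open>Table entries never underestimate, so the true distances are a feasible potential; this
  is the lower bound. For the upper bound \<open>last_hub\<close> supplies a hub close to
  \<open>h j\<close>, and the remaining piece is an exact entry of the table.\<close>

lemma potential_dist_hub_table:
  assumes i: "i < K" and j: "j < K"
  shows "potential_dist K (hub_table T) i j = d i (h j)"
proof (rule antisym)
  show "d i (h j) \<le> potential_dist K (hub_table T) i j"
  proof (rule potential_dist_ge[of "\<lambda>j. d i (h j)"])
    fix a b assume ab: "a < K" "b < K"
    have "d a (h b) \<le> hub_table T (a, b)" using ab by (auto simp: hub_table_def)
    then show "d i (h b) \<le> d i (h a) + hub_table T (a, b)"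
      using graph_dist_triangle[of G "h i" "h b" "h a"] by (meson add_left_mono order_trans)
  qed simp
next
  show "potential_dist K (hub_table T) i j \<le> d i (h j)"
  proof (cases "d i (h j)")
    case (enat x)
    obtain j' where j': "j' < K" "potential_dist K (hub_table T) i j' + d j' (h j) \<le> d i (h j)"
       "d j' (h j) < enat l" using last_hub[OF i enat] by blast
    have "potential_dist K (hub_table T) i j \<le> potential_dist K (hub_table T) i j' + hub_table T (j', j)"
      by (rule potential_dist_step[OF j'(1) j])
    also have "hub_table T (j', j) = d j' (h j)" using j' j by (intro hub_table_eq) auto
    finally show ?thesis using j'(2) by simp
  qed simp
qed

lemma src_table_valid: "src_table t \<in> {..<c} \<times> {..<n} \<rightarrow>\<^sub>E lengths"
proof -
  have *: "(INF j\<in>J. d i (h j) + d j v) \<in> lengths" if "i < c" "J \<subseteq> {..<K}" for i v J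
  proof (cases "(INF j\<in>J. d i (h j) + d j v) = \<infinity>")
    case False
    then have "J \<noteq> {}" by (auto simp: top_enat_def)
    then have "(INF j\<in>J. d i (h j) + d j v) \<in> (\<lambda>j. d i (h j) + d j v) ` J"
      unfolding Inf_enat_def by (auto intro: LeastI)
    then obtain j where j: "j \<in> J" "(INF j\<in>J. d i (h j) + d j v) = d i (h j) + d j v" by blast
    with False obtain a b where ab: "d i (h j) = enat a" "d j v = enat b"
      by (cases "d i (h j)"; cases "d j v") auto
    have "a < n" "b < n"
      using graph_dist_less[OF G h_less ab(1)] graph_dist_less[OF G h_less ab(2)] that c_le j(1) by auto
    then show ?thesis unfolding j(2) ab lengths_def by auto
  qed (simp add: lengths_def)
  show ?thesis by (auto simp: src_table_def intro!: *)
qed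

lemma src_table_0: "src_table 0 = (\<lambda>x\<in>{..<c} \<times> {..<n}. \<infinity>)"
  by (auto simp: src_table_def fun_eq_iff top_enat_def)

lemma record_src_dist_mk:
  "record_src_dist t (mk (Prev t) (Layer t) C (hub_table T) (src_table t) P) =
   mk (Prev t) (Layer t) C (hub_table T) (src_table (Suc t)) P"
proof -
  have "min (src_table t (i, v))
       (INF j \<in> {j. (j, v) \<in> Layer t}. potential_dist K (hub_table T) i j + enat (t - \<delta> j)) =
     src_table (Suc t) (i, v)" if iv: "i < c" "v < n" for i v
  proof -
    let ?J = "{j. j < K \<and> (\<exists>a. d j v = enat a \<and> a + \<delta> j < t)}"
    let ?f = "\<lambda>j. d i (h j) + d j v"
    have "potential_dist K (hub_table T) i j + enat (t - \<delta> j) = ?f j" if "(j, v) \<in> Layer t" for j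
      using that iv c_le by (auto simp: Layer_def potential_dist_hub_table)
    then have "(INF j \<in> {j. (j, v) \<in> Layer t}. potential_dist K (hub_table T) i j + enat (t - \<delta> j)) =
      (INF j \<in> {j. (j, v) \<in> Layer t}. ?f j)" by (intro INF_cong) auto
    moreover have "src_table t (i, v) = (INF j \<in> ?J. ?f j)" using iv by (simp add: src_table_def)
    moreover have "src_table (Suc t) (i, v) = (INF j \<in> ?J \<union> {j. (j, v) \<in> Layer t}. ?f j)"
      using iv by (auto simp: src_table_def Layer_def less_Suc_eq intro!: INF_cong)
    ultimately show ?thesis by (simp add: INF_union inf_min)
  qed
  then have "(\<lambda>(i, v)\<in>{..<c} \<times> {..<n}. min (src_table t (i, v))
       (INF j \<in> {j. (j, v) \<in> Layer t}. potential_dist K (hub_table T) i j + enat (t - \<delta> j))) =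
     src_table (Suc t)"
    by (auto simp: fun_eq_iff src_table_def)
  then show ?thesis by (simp add: record_src_dist_def)
qed

text \<open>The search from the last hub before \<open>v\<close> meets \<open>v\<close> in time. All
  other contributions are at least the distance by the triangle inequality.\<close>

lemma src_table_T:
  assumes iv: "i < c" "v < n" shows "src_table T (i, v) = d i v"
proof -
  let ?J = "{j. j < K \<and> (\<exists>a. d j v = enat a \<and> a + \<delta> j < T)}"
  have "(INF j \<in> ?J. d i (h j) + d j v) = d i v"
  proof (rule antisym)
    show "d i v \<le> (INF j \<in> ?J. d i (h j) + d j v)"
      by (intro INF_greatest graph_dist_triangle)
    show "(INF j \<in> ?J. d i (h j) + d j v) \<le> d i v"
    proof (cases "d i v")
      case (enat x)
      have i: "i < K" using iv c_le by simp
      obtain j where j: "j < K" "potential_dist K (hub_table T) i j + d j v \<le> d i v" "d j v < enat l"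
        using last_hub[OF i enat] by blast
      then obtain a where a: "d j v = enat a" "a < l" by (cases "d j v") auto
      have "\<delta> j < \<Delta>" using \<delta> j by auto
      then have "a + \<delta> j < T" using a T by linarith
      then have "j \<in> ?J" using j a by auto
      moreover have "d i (h j) + d j v \<le> d i v" using j i by (simp add: potential_dist_hub_table)
      ultimately show ?thesis by (rule INF_lower2)
    qed simp
  qed
  then show ?thesis using iv by (simp add: src_table_def)
qed

text \<open>Invariant: \<open>P (i, v)\<close> consists of the leading \<open>q - e\<close> bits of
  some parent. Only existence is maintained, so the witness may change from pass to pass until the
  last bit determines it.\<close>

lemma runs_find_parents:
  assumes sm: "F' \<in> small_sets" "F \<in> small_sets" "C \<in> small_sets"
  shows "e \<le> q \<Longrightarrow> P \<in> {..<c} \<times> {..<n} \<rightarrow>\<^sub>E {..<2 ^ (q - e)} \<Longrightarrow>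
    (\<And>i v. i < c \<Longrightarrow> v < n \<Longrightarrow> d i v \<noteq> 0 \<Longrightarrow> d i v \<noteq> \<infinity> \<Longrightarrow>
       \<exists>u<n. {u, v} \<in> G \<and> d i u + 1 = d i v \<and> u div 2 ^ e = P (i, v)) \<Longrightarrow>
    \<exists>P'. runs G states B (find_parents e) (mk F' F C (hub_table T) (src_table T) P)
        (mk F' F C (hub_table T) (src_table T) P') \<and>
      (\<forall>i<c. \<forall>v<n. d i v \<noteq> 0 \<longrightarrow> d i v \<noteq> \<infinity> \<longrightarrow> {P' (i, v), v} \<in> G \<and> d i (P' (i, v)) + 1 = d i v)"
proof (induction e arbitrary: P)
  case 0
  have "{P (i, v), v} \<in> G \<and> d i (P (i, v)) + 1 = d i v"
    if "i < c" "v < n" "d i v \<noteq> 0" "d i v \<noteq> \<infinity>" for i v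
    using 0(3)[OF that] by auto
  then show ?case by (auto intro!: exI[of _ P] runs_Nil)
next
  case (Suc e)
  let ?s = "mk F' F C (hub_table T) (src_table T) P"
  let ?I = "parent_pass e"
  define Q where "Q = (\<lambda>x\<in>{..<c} \<times> {..<n}. 2 * P x + of_bool (\<not> answer G ?I ?s x))"
  have lab: "labels ?I ?s = {..<c} \<times> {..<n}" by (simp add: parent_pass_def)
  have fin: "finite (labels ?I ?s)" "card (labels ?I ?s) \<le> B"
    using B by (auto simp: lab card_cartesian_product)
  have upd: "update ?I ?s (answer G ?I ?s) = mk F' F C (hub_table T) (src_table T) Q"
    by (simp add: parent_pass_def Q_def)
  have ans: "answer G ?I ?s (i, v) \<longleftrightarrow>
      (\<exists>u<n. {u, v} \<in> G \<and> d i u + 1 = d i v \<and> u div 2 ^ e = 2 * P (i, v))" if "i < c" "v < n" for i v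
  proof -
    have "query ?I ?s (i, v) = {{u, v} | u. u < n \<and> d i u + 1 = d i v \<and> u div 2 ^ e = 2 * P (i, v)}"
      using that by (simp add: parent_pass_def src_table_T cong: conj_cong)
    then show ?thesis using that by (auto simp: answer_def lab)
  qed
  have Q: "Q \<in> {..<c} \<times> {..<n} \<rightarrow>\<^sub>E {..<2 ^ (q - e)}"
  proof -
    have "2 * P x + of_bool b < 2 ^ (q - e)" if "x \<in> {..<c} \<times> {..<n}" for x and b :: bool
    proof -
      have "P x < 2 ^ (q - Suc e)" using Suc.prems(2) that by auto
      moreover have "q - e = Suc (q - Suc e)" using Suc.prems(1) by simp
      ultimately show ?thesis by (cases b) auto
    qed
    then show ?thesis by (auto simp: Q_def)
  qed
  have "{..<2 ^ (q - e)} \<subseteq> {..<2 ^ q :: nat}" by (auto intro: less_le_trans)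
  then have "Q \<in> {..<c} \<times> {..<n} \<rightarrow>\<^sub>E {..<2 ^ q}" using Q by (meson PiE_mono subsetD)
  then have st: "mk F' F C (hub_table T) (src_table T) Q \<in> states"
    using sm hub_table_valid src_table_valid by (intro mk_in_states) (auto simp: valid_tables_def)
  have inv: "\<exists>u<n. {u, v} \<in> G \<and> d i u + 1 = d i v \<and> u div 2 ^ e = Q (i, v)"
    if iv: "i < c" "v < n" "d i v \<noteq> 0" "d i v \<noteq> \<infinity>" for i v
  proof (cases "answer G ?I ?s (i, v)")
    case True
    then show ?thesis using ans iv by (auto simp: Q_def)
  next
    case False
    obtain u where u: "u < n" "{u, v} \<in> G" "d i u + 1 = d i v" "u div 2 ^ Suc e = P (i, v)"
      using Suc.prems(3)[OF iv] by blast
    \<comment> \<open>The parent \<open>u\<close> matching the old prefix does not continue with bit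
      \<open>0\<close>, hence with bit \<open>1\<close>.\<close>
    have "u div 2 ^ e \<noteq> 2 * P (i, v)" using False ans iv u by blast
    moreover have "u div 2 ^ e div 2 = P (i, v)" using u(4) by (simp only: power_Suc2 div_mult2_eq)
    ultimately have "u div 2 ^ e = 2 * P (i, v) + 1" by linarith
    then show ?thesis using False iv u by (auto simp: Q_def)
  qed
  obtain P' where P': "runs G states B (find_parents e) (mk F' F C (hub_table T) (src_table T) Q)
        (mk F' F C (hub_table T) (src_table T) P')"
      "\<forall>i<c. \<forall>v<n. d i v \<noteq> 0 \<longrightarrow> d i v \<noteq> \<infinity> \<longrightarrow> {P' (i, v), v} \<in> G \<and> d i (P' (i, v)) + 1 = d i v"
    using Suc.IH[OF _ Q inv] Suc.prems(1) by auto
  have "runs G states B (find_parents (Suc e)) ?s (mk F' F C (hub_table T) (src_table T) P')"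
    unfolding find_parents.simps by (rule runs_Cons[OF fin upd st P'(1)])
  then show ?case using P'(2) by blast
qed

theorem runs_program:
  "\<exists>s. runs G states B program (initial h \<delta>) s \<and> (\<forall>r \<in> h ` {..<c}. bfs_tree G r (trees s r))"
proof -
  let ?P = "\<lambda>x\<in>{..<c} \<times> {..<n}. 0 :: nat"
  have P: "?P \<in> {..<c} \<times> {..<n} \<rightarrow>\<^sub>E {..<2 ^ q}" by auto
  have P0: "?P \<in> {..<c} \<times> {..<n} \<rightarrow>\<^sub>E {..<2 ^ (q - q)}" by auto
  have empty: "{} \<in> small_sets" by (simp add: small_sets_def)
  have "\<exists>F'\<in>small_sets. \<exists>F\<in>small_sets. \<exists>C\<in>small_sets. runs G states B (sweep record_hub_dist)
     (mk {} {} {} (hub_table 0) (src_table 0) ?P) (mk F' F C (hub_table T) (src_table 0) ?P)"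
    by (rule runs_sweep[of hub_table "\<lambda>_. src_table 0"])
       (use hub_table_valid src_table_valid P empty record_hub_dist_mk in \<open>auto simp: valid_tables_def\<close>)
  then obtain F1' F1 C1 where C1: "C1 \<in> small_sets" and r1: "runs G states B (sweep record_hub_dist)
     (mk {} {} {} (hub_table 0) (src_table 0) ?P) (mk F1' F1 C1 (hub_table T) (src_table 0) ?P)" by blast
  have "\<exists>F'\<in>small_sets. \<exists>F\<in>small_sets. \<exists>C\<in>small_sets. runs G states B (sweep record_src_dist)
     (mk F1' F1 C1 (hub_table T) (src_table 0) ?P) (mk F' F C (hub_table T) (src_table T) ?P)"
    by (rule runs_sweep[of "\<lambda>_. hub_table T" src_table])
       (use hub_table_valid src_table_valid P C1 record_src_dist_mk in \<open>auto simp: valid_tables_def\<close>)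
  then obtain F' F C where sm: "F' \<in> small_sets" "F \<in> small_sets" "C \<in> small_sets"
    and r2: "runs G states B (sweep record_src_dist)
     (mk F1' F1 C1 (hub_table T) (src_table 0) ?P) (mk F' F C (hub_table T) (src_table T) ?P)" by blast
  \<comment> \<open>Since \<open>n \<le> 2 ^ q\<close>, the empty prefix \<open>0\<close> fits every
    parent.\<close>
  have inv: "\<exists>u<n. {u, v} \<in> G \<and> d i u + 1 = d i v \<and> u div 2 ^ q = ?P (i, v)"
    if iv: "i < c" "v < n" "d i v \<noteq> 0" "d i v \<noteq> \<infinity>" for i v
  proof -
    obtain a where "d i v = enat (Suc a)"
      using iv(3,4) by (metis enat.exhaust not0_implies_Suc zero_enat_def)
    moreover from this obtain u where u: "{u, v} \<in> G" "d i u = enat a" by (rule graph_dist_pred)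
    moreover have "u < n" using finite_graph_dist_imp_less[OF G h_less u(2)] iv c_le by simp
    moreover from this have "u div 2 ^ q = 0" using n_le by simp
    ultimately show ?thesis using iv by (intro exI[of _ u]) (simp add: one_enat_def)
  qed
  obtain P' where r3: "runs G states B (find_parents q) (mk F' F C (hub_table T) (src_table T) ?P)
      (mk F' F C (hub_table T) (src_table T) P')"
    and P': "\<And>i v. i < c \<Longrightarrow> v < n \<Longrightarrow> d i v \<noteq> 0 \<Longrightarrow> d i v \<noteq> \<infinity> \<Longrightarrow>
      {P' (i, v), v} \<in> G \<and> d i (P' (i, v)) + 1 = d i v"
    using runs_find_parents[OF sm order_refl P0 inv] by blast
  let ?s = "mk F' F C (hub_table T) (src_table T) P'"
  have "initial h \<delta> = mk {} {} {} (hub_table 0) (src_table 0) ?P"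
    by (simp add: initial_def hub_table_0 src_table_0)
  then have run: "runs G states B program (initial h \<delta>) ?s"
    unfolding program_def using runs_append[OF r1 runs_append[OF r2 r3]] by simp
  have "bfs_tree G r (trees ?s r)" if "r \<in> h ` {..<c}" for r
  proof -
    define i where "i = (SOME i. i < c \<and> h i = r)"
    have "\<exists>i. i < c \<and> h i = r" using that by auto
    from someI_ex[OF this] have i: "i < c" "h i = r" by (auto simp: i_def)
    have comp: "v < n" if v: "v \<in> component G r" for v
    proof -
      obtain a where "d i v = enat a" using v i by (auto simp: component_iff)
      then show ?thesis using finite_graph_dist_imp_less[OF G h_less, of i v a] i(1) c_le by simp
    qed
    have "bfs_tree G r {{P' (i, v), v} | v. v \<in> component G r \<and> v \<noteq> r}"
    proof (rule bfs_tree_of_parents)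
      fix v assume v: "v \<in> component G r" "v \<noteq> r"
      then have "d i v \<noteq> 0" "d i v \<noteq> \<infinity>" using i by (auto simp: component_iff)
      then show "{P' (i, v), v} \<in> G \<and> graph_dist G r (P' (i, v)) + 1 = graph_dist G r v"
        using P'[of i v] i comp[OF v(1)] by auto
    qed
    moreover have "trees ?s r = {{P' (i, v), v} | v. v \<in> component G r \<and> v \<noteq> r}"
    proof -
      have "v < n \<and> src_table T (i, v) \<noteq> \<infinity> \<and> v \<noteq> r \<longleftrightarrow> v \<in> component G r \<and> v \<noteq> r" for v
        using comp[of v] src_table_T[OF i(1), of v] i(2) by (metis component_iff)
      then show ?thesis by (simp add: trees_def i_def[symmetric])
    qed
    ultimately show ?thesis by simp
  qed
  with run show ?thesis by blast
qed

end

section \<open>Counting states and bad random choices\<close>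

text \<open>Enumerate a subset and pad with \<open>None\<close> to length \<open>m\<close>: every
  subset comes from a word over \<open>card X + 1\<close> letters. A layer thus costs
  logarithmically many bits per pair.\<close>

lemma card_bounded_subsets:
  assumes "finite X" shows "finite {A. A \<subseteq> X \<and> card A \<le> m}" "card {A. A \<subseteq> X \<and> card A \<le> m} \<le> (card X + 1) ^ m"
proof -
  let ?L = "{ys. set ys \<subseteq> insert None (Some ` X) \<and> length ys = m}"
  have fin: "finite ?L" using assms by (intro finite_lists_length_eq) auto
  have sub: "{A. A \<subseteq> X \<and> card A \<le> m} \<subseteq> (\<lambda>ys. {x. Some x \<in> set ys}) ` ?L"
  proof safe
    fix A assume A: "A \<subseteq> X" "card A \<le> m"
    then obtain xs where xs: "set xs = A" "distinct xs"
      using assms finite_distinct_list finite_subset by metis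
    have "length xs \<le> m" using xs A by (metis distinct_card)
    then have "map Some xs @ replicate (m - length xs) None \<in> ?L" using xs A by auto
    moreover have "A = {x. Some x \<in> set (map Some xs @ replicate (m - length xs) None)}"
      using xs by auto
    ultimately show "A \<in> (\<lambda>ys. {x. Some x \<in> set ys}) ` ?L" by (rule rev_image_eqI)
  qed
  show "finite {A. A \<subseteq> X \<and> card A \<le> m}" by (rule finite_subset[OF sub]) (use fin in auto)
  have "card {A. A \<subseteq> X \<and> card A \<le> m} \<le> card ?L" by (rule surj_card_le[OF fin sub])
  also have "\<dots> = (card X + 1) ^ m"
    using assms by (subst card_lists_length_eq) (auto simp: card_image)
  finally show "card {A. A \<subseteq> X \<and> card A \<le> m} \<le> (card X + 1) ^ m" .
qed

context hub_bfs
begin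

lemma small_sets_bound: "finite small_sets" "card small_sets \<le> (2 ^ q * n + 1) ^ cap"
  using card_bounded_subsets[of "{..<2 ^ q} \<times> {..<n} :: (nat \<times> nat) set" cap]
  by (simp_all add: small_sets_def card_cartesian_product)

lemma lengths_bound: "finite lengths" "card lengths = 2 * n + 2"
  by (auto simp: lengths_def card_image inj_on_def card_insert_if)

lemma states_bound:
  "finite states"
  "card states \<le> n ^ K * \<Delta> ^ K * ((2 ^ q * n + 1) ^ cap) ^ 3 * (2 * n + 2) ^ (K * K) * (2 * n + 2) ^ (c * n) *
     (2 ^ q) ^ (c * n)"
proof -
  let ?f = "\<lambda>s. (hub s, delay s, prev_layer s, cur_layer s, cand s, hub_dist s, src_dist s, parent s)"
  let ?R = "({..<K} \<rightarrow>\<^sub>E {..<n}) \<times> ({..<K} \<rightarrow>\<^sub>E {..<\<Delta>}) \<times> small_sets \<times> small_sets \<times> small_sets \<times>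
     ({..<K} \<times> {..<K} \<rightarrow>\<^sub>E lengths) \<times> ({..<c} \<times> {..<n} \<rightarrow>\<^sub>E lengths) \<times>
     ({..<c} \<times> {..<n} \<rightarrow>\<^sub>E {..<2 ^ q :: nat})"
  have inj: "inj_on ?f states" by (rule inj_onI) auto
  have sub: "?f ` states \<subseteq> ?R" by (auto simp: states_def)
  have fin: "finite ?R" using small_sets_bound lengths_bound by (intro finite_cartesian_product finite_PiE) auto
  show "finite states" using finite_subset[OF sub fin] inj by (rule finite_imageD)
  have "card states \<le> card ?R" by (rule card_inj_on_le[OF inj sub fin])
  also have "\<dots> = n ^ K * \<Delta> ^ K * card small_sets ^ 3 * (2 * n + 2) ^ (K * K) * (2 * n + 2) ^ (c * n) * (2 ^ q) ^ (c * n)"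
    by (simp add: card_cartesian_product card_PiE lengths_bound power3_eq_cube algebra_simps)
  also have "\<dots> \<le> n ^ K * \<Delta> ^ K * ((2 ^ q * n + 1) ^ cap) ^ 3 * (2 * n + 2) ^ (K * K) * (2 * n + 2) ^ (c * n) *
     (2 ^ q) ^ (c * n)"
    using small_sets_bound(2) by (intro mult_le_mono power_mono order_refl) auto
  finally show "card states \<le> \<dots>" .
qed

end

text \<open>The first \<open>c\<close> coordinates are free because sources will replace them. Each
  of the other \<open>k\<close> independent ones avoids \<open>X\<close> with frequency at most
  \<open>1 - l / n \<le> exp (- l / n)\<close>.\<close>

lemma card_avoiding_functions:
  assumes "X \<subseteq> {..<n}" "l \<le> card X" "n > 0"
  shows "real (card {g \<in> {..<c + k} \<rightarrow>\<^sub>E {..<n}. \<forall>i\<in>{c..<c + k}. g i \<notin> X}) \<le>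
    real n ^ (c + k) * exp (- real l * real k / real n)"
proof -
  let ?B = "\<lambda>i. if i < c then {..<n} else {..<n} - X"
  have "{g \<in> {..<c + k} \<rightarrow>\<^sub>E {..<n}. \<forall>i\<in>{c..<c + k}. g i \<notin> X} = PiE {..<c + k} ?B"
  proof (rule set_eqI)
    fix g :: "nat \<Rightarrow> nat"
    have "g i \<in> ?B i \<longleftrightarrow> g i \<in> {..<n} \<and> (c \<le> i \<longrightarrow> g i \<notin> X)" for i by simp
    then show "g \<in> {g \<in> {..<c + k} \<rightarrow>\<^sub>E {..<n}. \<forall>i\<in>{c..<c + k}. g i \<notin> X} \<longleftrightarrow> g \<in> PiE {..<c + k} ?B"
      unfolding mem_Collect_eq PiE_iff by (simp only: lessThan_iff atLeastLessThan_iff Ball_def) blast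
  qed
  then have "real (card {g \<in> {..<c + k} \<rightarrow>\<^sub>E {..<n}. \<forall>i\<in>{c..<c + k}. g i \<notin> X}) = (\<Prod>i<c + k. real (card (?B i)))"
    by (simp add: card_PiE)
  also have "\<dots> \<le> (\<Prod>i<c + k. real n * (if i < c then 1 else exp (- real l / real n)))"
  proof (rule prod_mono, safe)
    fix i
    have "card ({..<n} - X) = n - card X" "card X \<le> n"
      using assms(1) card_mono[of "{..<n}" X] by (auto simp: card_Diff_subset finite_subset)
    then have "real (card ({..<n} - X)) \<le> real n * (1 - real l / real n)"
      using assms(2,3) by (simp add: field_simps of_nat_diff)
    also have "\<dots> \<le> real n * exp (- real l / real n)"
      using exp_ge_add_one_self[of "- real l / real n"] by (intro mult_left_mono) auto
    finally show "real (card (?B i)) \<le> real n * (if i < c then 1 else exp (- real l / real n))" by simp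
  qed simp
  also have "\<dots> = real n ^ (c + k) * (\<Prod>i<c + k. if i < c then 1 else exp (- real l / real n))"
    by (simp add: prod.distrib)
  also have "(\<Prod>i<c + k. if i < c then 1 else exp (- real l / real n)) = (\<Prod>i\<in>{c..<c + k}. exp (- real l / real n))"
    by (rule prod.mono_neutral_cong_right) auto
  also have "\<dots> = exp (- real l * real k / real n)"
    by (simp add: exp_of_nat_mult[symmetric] mult.commute)
  finally show ?thesis .
qed

text \<open>Markov's inequality for \<open>2\<close> to the power of the load, which is a product of independent factors.\<close>

lemma card_overload:
  fixes f :: "nat \<Rightarrow> enat"
  shows "card {\<delta> \<in> {..<K} \<rightarrow>\<^sub>E {..<\<Delta>}. m < card {i. i < K \<and> f i + enat (\<delta> i) = enat t}} * 2 ^ m \<le> (\<Delta> + 1) ^ K"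
proof -
  let ?D = "{..<K} \<rightarrow>\<^sub>E {..<\<Delta>}" and ?X = "\<lambda>\<delta>. {i. i < K \<and> f i + enat (\<delta> i) = enat t}"
  let ?w = "\<lambda>i x. if f i + enat x = enat t then 2 else 1 :: nat"
  have fin: "finite ?D" by (intro finite_PiE) auto
  have "card {\<delta> \<in> ?D. m < card (?X \<delta>)} * 2 ^ m = (\<Sum>\<delta>\<in>{\<delta> \<in> ?D. m < card (?X \<delta>)}. 2 ^ m)" by simp
  also have "\<dots> \<le> (\<Sum>\<delta>\<in>{\<delta> \<in> ?D. m < card (?X \<delta>)}. 2 ^ card (?X \<delta>))"
    by (intro sum_mono power_increasing) auto
  also have "\<dots> \<le> (\<Sum>\<delta>\<in>?D. 2 ^ card (?X \<delta>))" using fin by (intro sum_mono2) auto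
  also have "\<dots> = (\<Sum>\<delta>\<in>?D. \<Prod>i<K. ?w i (\<delta> i))"
  proof (intro sum.cong refl)
    fix \<delta> :: "nat \<Rightarrow> nat"
    have "(\<Prod>i<K. ?w i (\<delta> i)) = (\<Prod>i\<in>?X \<delta>. 2)"
      by (rule prod.mono_neutral_cong_right) auto
    then show "2 ^ card (?X \<delta>) = (\<Prod>i<K. ?w i (\<delta> i))" by simp
  qed
  also have "\<dots> = (\<Prod>i<K. \<Sum>x<\<Delta>. ?w i x)" by (rule prod_sum_PiE[symmetric]) auto
  also have "\<dots> \<le> (\<Prod>i<K. \<Delta> + 1)"
  proof (intro prod_mono conjI)
    fix i
    have "(\<Sum>x<\<Delta>. ?w i x) = (\<Sum>x<\<Delta>. 1 + of_bool (f i + enat x = enat t))"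
      by (intro sum.cong) auto
    also have "\<dots> = \<Delta> + card ({..<\<Delta>} \<inter> {x. f i + enat x = enat t})"
      by (simp only: sum.distrib sum_of_bool_eq[OF finite_lessThan]) simp
    \<comment> \<open>At most one delay brings search \<open>i\<close> to the vertex at time
      \<open>t\<close>, and none does if the distance is infinite.\<close>
    also have "card ({..<\<Delta>} \<inter> {x. f i + enat x = enat t}) \<le> card {t - the_enat (f i)}"
      by (intro card_mono) (cases "f i"; auto)+
    finally show "(\<Sum>x<\<Delta>. ?w i x) \<le> \<Delta> + 1" by simp
  qed simp
  finally show ?thesis by simp
qed

text \<open>The expectation in the Markov bound as a power of two, which is to cancel against the
  first summand of \<open>vertex_load\<close>. It rests on \<open>1 + x \<le> exp x\<close> and
  \<open>exp 1 \<le> 4\<close>.\<close>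

lemma Suc_power_le:
  assumes "\<Delta> > 0" shows "real (\<Delta> + 1) ^ K \<le> real \<Delta> ^ K * 2 ^ (2 * (K div \<Delta> + 1))"
proof -
  have "real (\<Delta> + 1) ^ K = real \<Delta> ^ K * (1 + 1 / real \<Delta>) ^ K"
    using assms by (simp add: power_mult_distrib[symmetric] field_simps)
  also have "(1 + 1 / real \<Delta>) ^ K \<le> exp (1 / real \<Delta>) ^ K"
    by (intro power_mono exp_ge_add_one_self) auto
  also have "\<dots> = exp (real K / real \<Delta>)" by (simp add: exp_of_nat_mult[symmetric])
  also have "\<dots> \<le> exp (real (K div \<Delta> + 1))"
  proof -
    have "K \<le> \<Delta> * (K div \<Delta> + 1)"
      using assms by (metis add.commute dividend_less_div_times less_imp_le mult.commute mult_Suc_right plus_1_eq_Suc)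
    then have "real K \<le> real \<Delta> * real (K div \<Delta> + 1)" by (metis of_nat_le_iff of_nat_mult)
    then show ?thesis using assms by (simp add: field_simps)
  qed
  also have "\<dots> = exp 1 ^ (K div \<Delta> + 1)" using exp_of_nat_mult[of "K div \<Delta> + 1" "1 :: real"] by simp
  also have "\<dots> \<le> 4 ^ (K div \<Delta> + 1)" using exp_le by (intro power_mono) auto
  also have "\<dots> = 2 ^ (2 * (K div \<Delta> + 1))" by (simp only: power_mult) simp
  finally show ?thesis by (simp add: mult_left_mono)
qed

section \<open>Choice of the parameters\<close>

lemma all_edges_bound: "finite (all_edges n)" "card (all_edges n) \<le> n ^ 2"
proof -
  have sub: "all_edges n \<subseteq> (\<lambda>(u, v). {u, v}) ` ({..<n} \<times> {..<n})"
    by (auto simp: all_edges_def)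
  show "finite (all_edges n)" by (rule finite_subset[OF sub]) auto
  have "card (all_edges n) \<le> card ({..<n} \<times> {..<n})" by (rule surj_card_le[OF _ sub]) auto
  then show "card (all_edges n) \<le> n ^ 2" by (simp add: card_cartesian_product power2_eq_square)
qed

locale bfs_params =
  fixes n c k :: nat
  assumes c_pos: "1 \<le> c" and c_le_k: "c \<le> k" and k_le_n: "k \<le> n"
begin

text \<open>
  With this \<open>radius\<close> a fixed geodesic is missed by all random hubs with probability at most \<open>n\<close> to the
  power \<open>-4\<close>, and with this \<open>vertex_load\<close> a fixed vertex is overloaded at a fixed time with probability
  at most \<open>2\<close> to the power \<open>-8 lg\<close>.
\<close>

definition "lg = floorlog 2 n"
definition "hubs = c + k"
text \<open>One bit more than \<open>lg\<close>, as there can be up to \<open>2 * n\<close>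
  hubs.\<close>

definition "rounds = lg + 1"
definition "max_delay = n div k"
definition "radius = 4 * lg * (n div k + 1)"
definition "horizon = max_delay + radius"
definition "vertex_load = 2 * (hubs div max_delay + 1) + 8 * lg"
definition "layer_cap = n * vertex_load"
definition "counters = 2 * layer_cap + c * n"
text \<open>The summands bound, in units of \<open>lg\<close> bits: the program counter, hubs and
  delays, three layer sets of \<open>3 * layer_cap\<close> each, hub distances, source distances
  with parents, and the counters.\<close>

definition "bits = lg * (10 + 2 * hubs + 9 * layer_cap + 2 * (hubs * hubs) + 4 * (c * n) + 2 * counters)"

sublocale hub_bfs n c hubs rounds max_delay horizon layer_cap .

text \<open>\<open>init\<close> must be defined on every set; the default \<open>0\<close> is a
  valid node.\<close>

definition source :: "nat set \<Rightarrow> nat \<Rightarrow> nat" where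
  "source S i = (if S \<subseteq> {..<n} \<and> card S = c then sorted_list_of_set S ! i else 0)"

text \<open>Random nodes are drawn for all hubs and then overwritten in the first \<open>c\<close>
  places, which keeps \<open>seeds\<close> a plain product.\<close>

definition hub_choice :: "nat set \<Rightarrow> (nat \<Rightarrow> nat) \<Rightarrow> nat \<Rightarrow> nat" where
  "hub_choice S g = (\<lambda>i\<in>{..<hubs}. if i < c then source S i else g i)"

definition seeds :: "((nat \<Rightarrow> nat) \<times> (nat \<Rightarrow> nat)) set" where
  "seeds = ({..<hubs} \<rightarrow>\<^sub>E {..<n}) \<times> ({..<hubs} \<rightarrow>\<^sub>E {..<max_delay})"

definition start :: "nat set \<Rightarrow> bfs_state pmf" where
  "start S = map_pmf (\<lambda>(g, \<delta>). initial (hub_choice S g) \<delta>) (pmf_of_set seeds)"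

lemma lg: "n < 2 ^ lg" "1 \<le> lg" "real lg \<le> 1 + log 2 (real n)"
proof -
  have n: "n > 0" using c_pos c_le_k k_le_n by simp
  then show "n < 2 ^ lg" using floorlog_bounds[of n 2] by (simp add: lg_def)
  show "1 \<le> lg" using n by (simp add: lg_def floorlog_def)
  show "real lg \<le> 1 + log 2 (real n)" using n by (simp add: lg_def floorlog_def)
qed

lemma pos: "n > 0" "k > 0" "max_delay > 0" "hubs \<le> 2 * k"
  using c_pos c_le_k k_le_n by (auto simp: max_delay_def hubs_def div_greater_zero_iff)

lemma max_delay_bounds: "max_delay * k \<le> n" "n \<le> 2 * max_delay * k"
proof -
  show "max_delay * k \<le> n" by (simp add: max_delay_def)
  have "n < k * (max_delay + 1)"
    using pos(2) unfolding max_delay_def by (metis add.commute dividend_less_div_times mult.commute mult_Suc_right plus_1_eq_Suc)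
  also have "\<dots> \<le> k * (2 * max_delay)" using pos(3) by (intro mult_le_mono) auto
  finally show "n \<le> 2 * max_delay * k" by (simp add: mult.commute mult.left_commute)
qed

lemma source_less: "i < c \<Longrightarrow> source S i < n"
proof (cases "S \<subseteq> {..<n} \<and> card S = c")
  case True
  assume "i < c"
  then have "sorted_list_of_set S ! i \<in> set (sorted_list_of_set S)" using True by (intro nth_mem) auto
  also have "\<dots> = S" using True finite_subset[of S "{..<n}"] by simp
  finally show ?thesis using True by (auto simp: source_def)
qed (use pos in \<open>auto simp: source_def\<close>)

lemma source_image:
  assumes "S \<subseteq> {..<n}" "card S = c" shows "hub_choice S g ` {..<c} = S"
proof -
  have "hub_choice S g ` {..<c} = (\<lambda>i. sorted_list_of_set S ! i) ` {..<c}"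
    using assms by (intro image_cong) (auto simp: hub_choice_def hubs_def source_def)
  also have "\<dots> = set (sorted_list_of_set S)" using assms by (simp add: set_conv_nth image_def) blast
  also have "\<dots> = S" using assms finite_subset[of S "{..<n}"] by simp
  finally show ?thesis .
qed

lemma hub_choice_in: "g \<in> {..<hubs} \<rightarrow>\<^sub>E {..<n} \<Longrightarrow> hub_choice S g \<in> {..<hubs} \<rightarrow>\<^sub>E {..<n}"
  using source_less by (auto simp: hub_choice_def PiE_iff)

lemma seeds: "finite seeds" "seeds \<noteq> {}" "card seeds = n ^ hubs * max_delay ^ hubs"
  using pos by (auto simp: seeds_def PiE_eq_empty_iff card_cartesian_product card_PiE lessThan_empty_iff intro!: finite_PiE)

text \<open>Bounds the number of pairs of vertex and time in the union bound over overloads; it also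
  controls the program length.\<close>

lemma horizon_less: "n * (horizon + 1) \<le> 2 ^ (3 * lg + 2)"
proof -
  have "max_delay \<le> n" "n div k \<le> n" by (simp_all add: max_delay_def)
  then have "horizon + 1 \<le> n + 4 * lg * (n + 1) + 1"
    unfolding horizon_def radius_def by (intro add_mono mult_le_mono) auto
  also have "\<dots> = (4 * lg + 1) * (n + 1)" by (simp add: algebra_simps)
  also have "\<dots> \<le> 2 ^ (lg + 2) * 2 ^ lg"
  proof (rule mult_le_mono)
    have "lg < 2 ^ lg" by (rule less_exp)
    then have "4 * lg + 1 \<le> 4 * 2 ^ lg" by linarith
    then show "4 * lg + 1 \<le> 2 ^ (lg + 2)" by (simp add: power_add)
    show "n + 1 \<le> 2 ^ lg" using lg(1) by simp
  qed
  finally have "n * (horizon + 1) \<le> 2 ^ lg * (2 ^ (lg + 2) * 2 ^ lg)"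
    using lg(1) by (intro mult_le_mono) auto
  also have "\<dots> = 2 ^ (3 * lg + 2)" by (simp add: power_add[symmetric])
  finally show ?thesis .
qed

lemma configurations_le:
  "Suc (length program) * card states * (n ^ 2 + 1) ^ counters \<le> 2 ^ bits"
proof -
  have pw: "x ^ b \<le> 2 ^ (a * b)" if "x \<le> 2 ^ a" for x a b :: nat
    using that by (simp add: power_mono power_mult)
  have n1: "n + 1 \<le> 2 ^ lg" "n \<le> 2 ^ lg" using lg(1) by auto
  have h1: "horizon + 1 \<le> 2 ^ (3 * lg + 2)" using horizon_less pos(1)
    by (metis One_nat_def Suc_leI le_trans mult_le_mono1 nat_mult_1)
  have "lg < 2 ^ lg" by (rule less_exp)
  then have "lg + 1 + 2 \<le> 4 * 2 ^ lg" using lg(2) by linarith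
  then have r: "rounds + 2 \<le> 2 ^ (lg + 2)" by (simp add: rounds_def power_add)
  have "Suc (length program) \<le> 2 ^ 2 * ((horizon + 1) * (rounds + 2))"
    by (simp add: length_program algebra_simps)
  also have "\<dots> \<le> 2 ^ 2 * (2 ^ (3 * lg + 2) * 2 ^ (lg + 2))" using h1 r by (intro mult_le_mono) auto
  also have "\<dots> = 2 ^ (4 * lg + 6)"
    unfolding power_add[symmetric] by (rule arg_cong[of _ _ "power 2"]) simp
  also have "\<dots> \<le> 2 ^ (10 * lg)" using lg(2) by (intro power_increasing) auto
  finally have f0: "Suc (length program) \<le> 2 ^ (10 * lg)" .
  have f1: "n ^ hubs \<le> 2 ^ (lg * hubs)" by (rule pw[OF n1(2)])
  have "max_delay \<le> n" by (simp add: max_delay_def)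
  then have f2: "max_delay ^ hubs \<le> 2 ^ (lg * hubs)" using n1 by (intro pw) simp
  have "2 ^ rounds * n + 1 \<le> 2 ^ rounds * (n + 1)" by simp
  also have "\<dots> \<le> 2 ^ rounds * 2 ^ lg" using n1 by (intro mult_le_mono) auto
  also have "\<dots> = 2 ^ (2 * lg + 1)" by (simp add: rounds_def power_add[symmetric])
  also have "\<dots> \<le> 2 ^ (3 * lg)" using lg(2) by (intro power_increasing) auto
  finally have "(2 ^ rounds * n + 1) ^ layer_cap \<le> 2 ^ (3 * lg * layer_cap)" by (rule pw)
  then have f3: "((2 ^ rounds * n + 1) ^ layer_cap) ^ 3 \<le> 2 ^ (3 * lg * layer_cap * 3)" by (rule pw)
  have "2 * n + 2 \<le> 2 ^ (lg + 1)" using n1 by simp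
  also have "\<dots> \<le> 2 ^ (2 * lg)" using lg(2) by (intro power_increasing) auto
  finally have f4: "(2 * n + 2) ^ x \<le> 2 ^ (2 * lg * x)" for x by (rule pw)
  have f5: "(2 ^ rounds) ^ (c * n) \<le> (2 :: nat) ^ (2 * lg * (c * n))"
    using lg(2) by (intro pw power_increasing) (auto simp: rounds_def)
  have "n ^ 2 + 1 \<le> (n + 1) ^ 2" by (simp add: power2_eq_square)
  also have "\<dots> \<le> 2 ^ (2 * lg)" using pw[OF n1(1), of 2] by (simp add: mult.commute)
  finally have f6: "(n ^ 2 + 1) ^ counters \<le> 2 ^ (2 * lg * counters)" by (rule pw)
  have "Suc (length program) * card states * (n ^ 2 + 1) ^ counters \<le>
     2 ^ (10 * lg) * (2 ^ (lg * hubs) * 2 ^ (lg * hubs) * 2 ^ (3 * lg * layer_cap * 3) *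
       2 ^ (2 * lg * (hubs * hubs)) * 2 ^ (2 * lg * (c * n)) * 2 ^ (2 * lg * (c * n))) * 2 ^ (2 * lg * counters)"
    by (intro mult_le_mono f0 f6 order_trans[OF states_bound(2)] f1 f2 f3 f4 f5)
  also have "\<dots> = 2 ^ bits" unfolding bits_def power_add[symmetric]
    by (rule arg_cong[of _ _ "\<lambda>x. 2 ^ x"]) (simp add: algebra_simps)
  finally show ?thesis .
qed

sublocale pass_program states counters program "n ^ 2 + 1" bits start trees
proof
  show "set_pmf (start S) \<subseteq> states" for S
    using seeds by (auto simp: start_def) (auto simp: seeds_def intro!: initial_in_states hub_choice_in)
qed (use states_bound(1) configurations_le in auto)

definition "algorithm = compile"

definition "passes = length program"

lemma uses_space_algorithm: "uses_space algorithm bits"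
  unfolding algorithm_def by (rule uses_space_compile)

text \<open>The origin of \<open>k ^ 2\<close>: the factor \<open>n\<close> is traded for
  \<open>2 * max_delay * k\<close>, and \<open>max_delay\<close> cancels the division in the average
  load, leaving \<open>2 * k\<close> times the number of hubs.\<close>

lemma layer_cap_le: "layer_cap \<le> 10 * (lg * (c * n + k ^ 2))"
proof -
  have "n * (hubs div max_delay) \<le> 2 * max_delay * k * (hubs div max_delay)"
    using max_delay_bounds(2) by (rule mult_le_mono1)
  also have "\<dots> = 2 * k * (hubs div max_delay * max_delay)" by (simp add: algebra_simps)
  also have "\<dots> \<le> 2 * k * (2 * k)" using pos(4) by (intro mult_le_mono order_trans[OF div_times_less_eq_dividend]) auto
  finally have "n * (hubs div max_delay) \<le> 4 * k ^ 2" by (simp add: power2_eq_square)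
  then have "layer_cap \<le> 8 * k ^ 2 + 2 * n + 8 * (lg * n)"
    by (simp add: layer_cap_def vertex_load_def algebra_simps)
  also have "\<dots> \<le> 8 * (lg * k ^ 2) + 2 * (lg * (c * n)) + 8 * (lg * (c * n))"
    using lg(2) c_pos by (intro add_mono mult_le_mono) auto
  also have "\<dots> \<le> 10 * (lg * (c * n + k ^ 2))" by (simp add: algebra_simps)
  finally show ?thesis .
qed

text \<open>One logarithm comes from \<open>vertex_load\<close>, the other from the bits per stored
  entry.\<close>

lemma bits_le: "real bits \<le> 200 * (real c * real n + real k ^ 2) * (1 + log 2 (real n)) ^ 2"
proof -
  define w where "w = lg * (c * n + k ^ 2)"
  have w: "c * n + k ^ 2 \<le> w" unfolding w_def using mult_le_mono1[OF lg(2), of "c * n + k ^ 2"] by simp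
  have "1 \<le> k" using pos(2) by simp
  then have "1 \<le> k ^ 2" "k \<le> k ^ 2" by (simp_all add: power2_eq_square)
  then have W: "1 \<le> w" "c * n \<le> w" "k \<le> w" "k ^ 2 \<le> w" using w by linarith+
  have "hubs * hubs \<le> (2 * k) * (2 * k)" using pos(4) by (intro mult_le_mono)
  then have hh: "hubs * hubs \<le> 4 * w" using W(4) by (simp add: power2_eq_square)
  have "layer_cap \<le> 10 * w" using layer_cap_le by (simp add: w_def)
  then have "9 * layer_cap \<le> 90 * w" "2 * hubs \<le> 4 * w" "2 * (hubs * hubs) \<le> 8 * w"
      "4 * (c * n) \<le> 4 * w" "2 * counters \<le> 42 * w" "10 \<le> 10 * w"
    unfolding counters_def using pos(4) hh W by simp_all
  then have "10 + 2 * hubs + 9 * layer_cap + 2 * (hubs * hubs) + 4 * (c * n) + 2 * counters \<le>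
      10 * w + 4 * w + 90 * w + 8 * w + 4 * w + 42 * w"
    by (intro add_mono)
  then have "10 + 2 * hubs + 9 * layer_cap + 2 * (hubs * hubs) + 4 * (c * n) + 2 * counters \<le> 200 * w"
    by simp
  then have "bits \<le> lg * (200 * w)" unfolding bits_def by (rule mult_le_mono2)
  then have "real bits \<le> real (lg * (200 * w))" by (rule of_nat_mono)
  also have "\<dots> = 200 * (real c * real n + real k ^ 2) * real lg ^ 2"
    by (simp add: w_def power2_eq_square algebra_simps)
  also have "\<dots> \<le> 200 * (real c * real n + real k ^ 2) * (1 + log 2 (real n)) ^ 2"
    using lg(3) by (intro mult_left_mono power_mono) auto
  finally show ?thesis .
qed

text \<open>One logarithm comes from \<open>radius\<close>, the other from the bisection at every
  time step.\<close>

lemma passes_le: "real passes \<le> 100 * (real n / real k) * (1 + log 2 (real n)) ^ 2"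
proof -
  have D: "1 \<le> max_delay" using pos by simp
  have "horizon \<le> 9 * (lg * max_delay)"
  proof -
    have "max_delay + 4 * lg * (max_delay + 1) \<le> lg * max_delay + 4 * lg * (max_delay + max_delay)"
      using lg(2) D by (intro add_mono mult_le_mono) auto
    then show ?thesis by (simp add: horizon_def radius_def max_delay_def algebra_simps)
  qed
  then have "horizon * (rounds + 2) \<le> 9 * (lg * max_delay) * (4 * lg)"
    using lg(2) by (intro mult_le_mono) (auto simp: rounds_def)
  then have 1: "horizon * (rounds + 2) \<le> 36 * (lg * lg * max_delay)" by (simp add: algebra_simps)
  have 2: "1 \<le> lg * lg * max_delay" "lg \<le> lg * lg * max_delay" using lg(2) D by auto
  have "2 * (horizon * (rounds + 2) + 1) + rounds \<le>
      2 * (36 * (lg * lg * max_delay) + lg * lg * max_delay) + (lg * lg * max_delay + lg * lg * max_delay)"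
    unfolding rounds_def using 1 2 by (intro add_mono mult_le_mono2) (simp_all add: rounds_def)
  then have "passes \<le> 100 * (lg * lg * max_delay)"
    unfolding passes_def length_program by simp
  then have "real passes \<le> real (100 * (lg * lg * max_delay))" by (rule of_nat_mono)
  also have "\<dots> = 100 * real max_delay * real lg ^ 2" by (simp add: power2_eq_square)
  also have "\<dots> \<le> 100 * (real n / real k) * (1 + log 2 (real n)) ^ 2"
  proof (intro mult_mono power_mono lg(3))
    have "real (max_delay * k) \<le> real n" using max_delay_bounds(1) by (rule of_nat_mono)
    then show "real max_delay \<le> real n / real k" using pos(2) by (simp add: field_simps)
  qed auto
  finally show ?thesis .
qed

section \<open>Failure probability of the random choices\<close>

context
  fixes G :: "nat set set" and S :: "nat set"
  assumes G: "G \<subseteq> all_edges n" and S: "S \<subseteq> {..<n}" "card S = c" and n2: "2 \<le> n"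
begin

text \<open>Omitting \<open>u\<close>, as \<open>hit\<close> requires, still leaves at least
  \<open>radius\<close> vertices for a pair at that distance.\<close>

definition inner :: "nat \<Rightarrow> nat \<Rightarrow> nat set" where
  "inner u v = {x. x < n \<and> x \<noteq> u \<and> graph_dist G u x + graph_dist G x v = enat radius}"

definition missing :: "(nat \<Rightarrow> nat) set" where
  "missing = (\<Union>(u, v)\<in>{(u, v). u < n \<and> v < n \<and> graph_dist G u v = enat radius}.
     {g \<in> {..<hubs} \<rightarrow>\<^sub>E {..<n}. \<forall>i\<in>{c..<hubs}. g i \<notin> inner u v})"

definition load_set :: "(nat \<Rightarrow> nat) \<Rightarrow> (nat \<Rightarrow> nat) \<Rightarrow> nat \<Rightarrow> nat \<Rightarrow> nat set" where
  "load_set h \<delta> v t = {i. i < hubs \<and> graph_dist G (h i) v + enat (\<delta> i) = enat t}"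

definition congested :: "(nat \<Rightarrow> nat) \<Rightarrow> (nat \<Rightarrow> nat) set" where
  "congested h = (\<Union>(v, t)\<in>{..<n} \<times> {..horizon}.
     {\<delta> \<in> {..<hubs} \<rightarrow>\<^sub>E {..<max_delay}. vertex_load < card (load_set h \<delta> v t)})"

lemma good_hubsI:
  assumes g: "g \<in> {..<hubs} \<rightarrow>\<^sub>E {..<n}" "g \<notin> missing"
    and \<delta>: "\<delta> \<in> {..<hubs} \<rightarrow>\<^sub>E {..<max_delay}" "\<delta> \<notin> congested (hub_choice S g)"
  shows "good_hubs n c hubs rounds max_delay horizon layer_cap G (hub_choice S g) \<delta> radius counters"
proof
  let ?h = "hub_choice S g"
  show "?h \<in> {..<hubs} \<rightarrow>\<^sub>E {..<n}" using g by (rule_tac hub_choice_in)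
  show "hubs \<le> 2 ^ rounds" using pos(4) k_le_n lg(1) by (simp add: rounds_def)
  show "n \<le> 2 ^ rounds" using lg(1) by (simp add: rounds_def)
  show "n \<le> layer_cap" by (simp add: layer_cap_def vertex_load_def)
  show "\<exists>j<hubs. ?h j \<noteq> u \<and> graph_dist G u (?h j) + graph_dist G (?h j) v = enat radius"
    if uv: "u < n" "v < n" "graph_dist G u v = enat radius" for u v
  proof -
    obtain i where "i \<in> {c..<hubs}" "g i \<in> inner u v"
      using g uv unfolding missing_def by blast
    then show ?thesis by (intro exI[of _ i]) (auto simp: inner_def hub_choice_def)
  qed
  show "card {(i, v). i < hubs \<and> v < n \<and> graph_dist G (?h i) v + enat (\<delta> i) = enat t} \<le> layer_cap"
    if t: "t \<le> horizon" for t
  proof -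
    have "{(i, v). i < hubs \<and> v < n \<and> graph_dist G (?h i) v + enat (\<delta> i) = enat t} =
       prod.swap ` (SIGMA v:{..<n}. load_set ?h \<delta> v t)"
      by (auto simp: load_set_def image_iff)
    then have "card {(i, v). i < hubs \<and> v < n \<and> graph_dist G (?h i) v + enat (\<delta> i) = enat t} \<le>
       card (SIGMA v:{..<n}. load_set ?h \<delta> v t)"
      using card_image_le[of "SIGMA v:{..<n}. load_set ?h \<delta> v t" prod.swap] by (simp add: load_set_def)
    also have "\<dots> = (\<Sum>v<n. card (load_set ?h \<delta> v t))" by (simp add: load_set_def)
    also have "\<dots> \<le> (\<Sum>v<n. vertex_load)"
    proof (rule sum_mono)
      fix v assume v: "v \<in> {..<n}"
      show "card (load_set ?h \<delta> v t) \<le> vertex_load"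
      proof (rule ccontr)
        assume "\<not> ?thesis"
        then have "\<delta> \<in> congested ?h"
          unfolding congested_def using t v \<delta>(1) by (intro UN_I[of "(v, t)"]) auto
        then show False using \<delta>(2) by contradiction
      qed
    qed
    finally show ?thesis by (simp add: layer_cap_def)
  qed
qed (use G \<delta> in \<open>auto simp: hubs_def rounds_def horizon_def counters_def\<close>)

text \<open>At most \<open>n ^ 2\<close> pairs are each missed with frequency at most
  \<open>1 / n ^ 4\<close>; since \<open>n\<close> is at least 2, the total is within
  \<open>1 / (2 * n)\<close>.\<close>

lemma card_missing: "real (card missing) \<le> real n ^ hubs / (2 * real n)"
proof -
  let ?I = "{(u, v). u < n \<and> v < n \<and> graph_dist G u v = enat radius}"
  have subI: "?I \<subseteq> {..<n} \<times> {..<n}" by auto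
  have finI: "finite ?I" by (rule finite_subset[OF subI]) auto
  have "card ?I \<le> card ({..<n} \<times> {..<n})" by (rule card_mono[OF _ subI]) auto
  then have cardI: "real (card ?I) \<le> real n ^ 2"
    by (simp add: card_cartesian_product power2_eq_square flip: of_nat_mult)
  have one: "real (card {g \<in> {..<hubs} \<rightarrow>\<^sub>E {..<n}. \<forall>i\<in>{c..<hubs}. g i \<notin> inner u v}) \<le> real n ^ hubs / real n ^ 4"
    if uv: "(u, v) \<in> ?I" for u v
  proof -
    have "Suc radius \<le> card {x. x < n \<and> graph_dist G u x + graph_dist G x v = enat radius}"
      using card_geodesic_ge[OF G] uv by blast
    also have "\<dots> \<le> card (insert u (inner u v))" by (intro card_mono) (auto simp: inner_def)
    also have "\<dots> = Suc (card (inner u v))" by (subst card_insert_disjoint) (auto simp: inner_def)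
    finally have "radius \<le> card (inner u v)" by simp
    then have "real (card {g \<in> {..<hubs} \<rightarrow>\<^sub>E {..<n}. \<forall>i\<in>{c..<hubs}. g i \<notin> inner u v}) \<le>
       real n ^ hubs * exp (- real radius * real k / real n)"
      unfolding hubs_def using pos(1) by (intro card_avoiding_functions) (auto simp: inner_def)
    also have "\<dots> \<le> real n ^ hubs * (1 / real n ^ 4)"
    proof (intro mult_left_mono)
      \<comment> \<open>The \<open>+ 1\<close> in \<open>radius\<close> makes up for rounding in
        \<open>n div k\<close>, so that \<open>radius * k / n\<close> is at least
        \<open>4 * lg\<close>.\<close>
      have "n \<le> (n div k + 1) * k"
        using pos(2) by (metis add.commute dividend_less_div_times less_imp_le mult_Suc plus_1_eq_Suc)
      then have "4 * lg * n \<le> radius * k" by (simp add: radius_def mult.assoc del: mult_Suc mult_Suc_right)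
      then have "real (4 * lg) * real n \<le> real radius * real k" by (metis of_nat_le_iff of_nat_mult)
      then have "real (4 * lg) \<le> real radius * real k / real n" using pos(1) by (simp add: field_simps)
      then have "exp (- real radius * real k / real n) \<le> exp (- real (4 * lg))" by simp
      also have "\<dots> = 1 / exp 1 ^ (4 * lg)" using exp_of_nat_mult[of "4 * lg" "1 :: real"]
        by (simp add: exp_minus field_simps)
      also have "\<dots> \<le> 1 / 2 ^ (4 * lg)"
        using exp_ge_add_one_self[of 1] by (intro divide_left_mono power_mono) auto
      also have "\<dots> \<le> 1 / real n ^ 4"
      proof (intro divide_left_mono)
        have "real n \<le> 2 ^ lg" using lg(1) by (metis less_imp_le of_nat_le_iff of_nat_numeral of_nat_power)
        then have "real n ^ 4 \<le> (2 ^ lg) ^ 4" by (intro power_mono) auto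
        then show "real n ^ 4 \<le> 2 ^ (4 * lg)" by (simp add: power_mult[symmetric] mult.commute)
      qed (use pos in auto)
      finally show "exp (- real radius * real k / real n) \<le> 1 / real n ^ 4" .
    qed simp
    finally show ?thesis by simp
  qed
  have "real (card missing) \<le> (\<Sum>(u, v)\<in>?I. real (card {g \<in> {..<hubs} \<rightarrow>\<^sub>E {..<n}. \<forall>i\<in>{c..<hubs}. g i \<notin> inner u v}))"
    unfolding missing_def using card_UN_le[OF finI, of "\<lambda>(u, v). {g \<in> {..<hubs} \<rightarrow>\<^sub>E {..<n}. \<forall>i\<in>{c..<hubs}. g i \<notin> inner u v}"]
    by (simp add: case_prod_unfold flip: of_nat_sum)
  also have "\<dots> \<le> (\<Sum>(u, v)\<in>?I. real n ^ hubs / real n ^ 4)" using one by (intro sum_mono) auto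
  also have "\<dots> = real (card ?I) * (real n ^ hubs / real n ^ 4)" by (simp add: case_prod_unfold)
  also have "\<dots> \<le> real n ^ 2 * (real n ^ hubs / real n ^ 4)" using cardI by (intro mult_right_mono) auto
  also have "\<dots> = real n ^ hubs / real n ^ 2" using pos(1) by (simp add: field_simps power_numeral_reduce)
  also have "\<dots> \<le> real n ^ hubs / (2 * real n)"
    using n2 by (intro divide_left_mono) (auto simp: power2_eq_square)
  finally show ?thesis .
qed

text \<open>The second summand of \<open>vertex_load\<close> leaves the factor
  \<open>2 ^ (8 * lg)\<close>, which pays for the pairs of vertex and time and for
  \<open>2 * n\<close>. As \<open>h\<close> is arbitrary, the bound applies to the delays after any
  choice of hubs.\<close>

lemma card_congested: "real (card (congested h)) \<le> real max_delay ^ hubs / (2 * real n)"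
proof -
  let ?I = "{..<n} \<times> {..horizon}"
  let ?B = "\<lambda>v t. {\<delta> \<in> {..<hubs} \<rightarrow>\<^sub>E {..<max_delay}. vertex_load < card (load_set h \<delta> v t)}"
  have one: "real (card (?B v t)) \<le> real max_delay ^ hubs / 2 ^ (8 * lg)" for v t
  proof -
    let ?e = "2 * (hubs div max_delay + 1)"
    have "card (?B v t) * 2 ^ vertex_load \<le> (max_delay + 1) ^ hubs"
      unfolding load_set_def by (rule card_overload[of hubs max_delay vertex_load "\<lambda>i. graph_dist G (h i) v" t])
    then have "real (card (?B v t)) * 2 ^ vertex_load \<le> real (max_delay + 1) ^ hubs"
      by (metis (mono_tags, lifting) of_nat_le_iff of_nat_mult of_nat_numeral of_nat_power)
    also have "\<dots> \<le> real max_delay ^ hubs * 2 ^ ?e" by (rule Suc_power_le[OF pos(3)])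
    finally have "real (card (?B v t)) * 2 ^ (8 * lg) * 2 ^ ?e \<le> real max_delay ^ hubs * 2 ^ ?e"
      unfolding vertex_load_def power_add by (simp only: mult_ac)
    then have "real (card (?B v t)) * 2 ^ (8 * lg) \<le> real max_delay ^ hubs"
      by (rule mult_right_le_imp_le) simp
    then show ?thesis by (simp add: field_simps)
  qed
  have "real (card (congested h)) \<le> (\<Sum>(v, t)\<in>?I. real (card (?B v t)))"
    unfolding congested_def using card_UN_le[of ?I "\<lambda>(v, t). ?B v t"]
    by (simp add: case_prod_unfold flip: of_nat_sum)
  also have "\<dots> \<le> (\<Sum>(v, t)\<in>?I. real max_delay ^ hubs / 2 ^ (8 * lg))" using one by (intro sum_mono) auto
  also have "\<dots> = real (n * (horizon + 1)) * (real max_delay ^ hubs / 2 ^ (8 * lg))"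
    by (simp add: case_prod_unfold card_cartesian_product)
  also have "\<dots> \<le> 2 ^ (3 * lg + 2) * (real max_delay ^ hubs / 2 ^ (8 * lg))"
  proof (intro mult_right_mono)
    show "real (n * (horizon + 1)) \<le> 2 ^ (3 * lg + 2)"
      using horizon_less by (metis of_nat_le_iff of_nat_numeral of_nat_power)
  qed simp
  also have "\<dots> = real max_delay ^ hubs * (2 ^ (3 * lg + 2) / 2 ^ (8 * lg))" by simp
  also have "\<dots> \<le> real max_delay ^ hubs * (1 / (2 * real n))"
  proof (intro mult_left_mono)
    have "2 ^ (3 * lg + 2) * (2 * real n) \<le> 2 ^ (3 * lg + 2) * (2 * 2 ^ lg)"
      using lg(1) by (simp add: less_imp_le)
    also have "\<dots> = 2 ^ (4 * lg + 3)"
      unfolding power_Suc[symmetric] power_add[symmetric] by (rule arg_cong[of _ _ "power 2"]) simp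
    also have "\<dots> \<le> (2 :: real) ^ (8 * lg)" using lg(2) by (intro power_increasing) auto
    finally show "2 ^ (3 * lg + 2) / 2 ^ (8 * lg) \<le> 1 / (2 * real n)" using pos(1) by (simp add: field_simps)
  qed simp
  finally show ?thesis by simp
qed

text \<open>Half of the failure budget goes to the hubs with arbitrary delays, the other half to the
  delays. Congestion depends on the hubs, hence the dependent product in
  \<open>?bad\<close>.\<close>

lemma start_good:
  "measure_pmf.prob (start S) {s. \<exists>s'. runs G states counters program s s' \<and> (\<forall>r\<in>S. bfs_tree G r (trees s' r))} \<ge> 1 - 1 / real n"
proof -
  let ?X = "{s. \<exists>s'. runs G states counters program s s' \<and> (\<forall>r\<in>S. bfs_tree G r (trees s' r))}"
  let ?gs = "{..<hubs} \<rightarrow>\<^sub>E {..<n}" and ?ds = "{..<hubs} \<rightarrow>\<^sub>E {..<max_delay}"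
  let ?f = "\<lambda>(g, \<delta>). initial (hub_choice S g) \<delta>"
  let ?bad = "missing \<times> ?ds \<union> (SIGMA g:?gs. congested (hub_choice S g))"
  have fin: "finite ?gs" "finite ?ds" by (auto intro!: finite_PiE)
  have sub: "missing \<subseteq> ?gs" "congested h \<subseteq> ?ds" for h by (auto simp: missing_def congested_def)
  have fin': "finite missing" "finite (congested h)" for h 
    using finite_subset[OF sub(1) fin(1)] finite_subset[OF sub(2) fin(2)] by auto
  have good: "seeds - ?bad \<subseteq> seeds \<inter> ?f -` ?X"
  proof
    fix x assume x: "x \<in> seeds - ?bad"
    obtain g \<delta> where [simp]: "x = (g, \<delta>)" by (cases x)
    interpret good_hubs n c hubs rounds max_delay horizon layer_cap G "hub_choice S g" \<delta> radius counters
      using x by (intro good_hubsI) (auto simp: seeds_def)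
    show "x \<in> seeds \<inter> ?f -` ?X"
      using runs_program x source_image[OF S] by auto
  qed
  have "real (card ?bad) \<le> real (card (missing \<times> ?ds)) + real (card (SIGMA g:?gs. congested (hub_choice S g)))"
    using card_Un_le[of "missing \<times> ?ds" "SIGMA g:?gs. congested (hub_choice S g)"] by (simp flip: of_nat_add)
  also have "real (card (missing \<times> ?ds)) = real (card missing) * real max_delay ^ hubs"
    by (simp add: card_cartesian_product card_PiE)
  also have "\<dots> \<le> real n ^ hubs / (2 * real n) * real max_delay ^ hubs"
    by (intro mult_right_mono card_missing) auto
  also have "real (card (SIGMA g:?gs. congested (hub_choice S g))) = (\<Sum>g\<in>?gs. real (card (congested (hub_choice S g))))"
    using fin fin' by (subst card_SigmaI) auto
  also have "\<dots> \<le> (\<Sum>g\<in>?gs. real max_delay ^ hubs / (2 * real n))" by (intro sum_mono card_congested)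
  also have "\<dots> = real n ^ hubs * (real max_delay ^ hubs / (2 * real n))" by (simp add: card_PiE)
  finally have bad: "real (card ?bad) \<le> real (card seeds) / real n"
    using pos(1) by (simp add: seeds field_simps)
  have "real (card seeds) - real (card ?bad) \<le> real (card (seeds - ?bad))"
    using diff_card_le_card_Diff[of ?bad seeds] fin fin' by (simp add: finite_SigmaI)
  also have "\<dots> \<le> real (card (seeds \<inter> ?f -` ?X))"
    using seeds by (intro of_nat_mono card_mono good) auto
  finally have "real (card seeds) * (1 - 1 / real n) \<le> real (card (seeds \<inter> ?f -` ?X))"
    using bad by (simp add: algebra_simps)
  moreover have "card seeds > 0" using seeds(1,2) by (intro iffD2[OF card_gt_0_iff] conjI)
  ultimately have "1 - 1 / real n \<le> real (card (seeds \<inter> ?f -` ?X)) / real (card seeds)"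
    by (simp add: field_simps)
  also have "\<dots> = measure_pmf.prob (start S) ?X"
    unfolding start_def measure_map_pmf using seeds by (subst measure_pmf_of_set) auto
  finally show ?thesis .
qed

end

theorem algorithm_correct:
  assumes S: "S \<subseteq> {..<n}" "card S = c" and us: "turnstile_stream n us"
  shows "measure_pmf.prob (run_alg algorithm passes S us)
     {T. \<forall>r\<in>S. bfs_tree (final_graph us) r (T r)} \<ge> 1 - 1 / real n"
proof (cases "2 \<le> n")
  case True
  have us': "update_item ` set us \<subseteq> all_edges n" "\<And>e. net_mult us e \<in> {0, 1}"
    using us by (auto simp: turnstile_stream_def)
  have "1 - 1 / real n \<le> measure_pmf.prob (start S) {s. \<exists>s'. runs (final_graph us) states counters program s s' \<and>
     (\<forall>r\<in>S. bfs_tree (final_graph us) r (trees s' r))}"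
    by (rule start_good[OF final_graph_subset[OF us'(1)] S True])
  also have "\<dots> \<le> measure_pmf.prob (run_alg compile (length program) S us)
     {T. \<forall>r\<in>S. bfs_tree (final_graph us) r (T r)}"
    using compile_correct[OF all_edges_bound(1) _ us', of S "{T. \<forall>r\<in>S. bfs_tree (final_graph us) r (T r)}"]
      all_edges_bound(2)[of n] by simp
  finally show ?thesis unfolding algorithm_def passes_def .
next
  case False
  \<comment> \<open>Here the claimed bound \<open>1 - 1 / real n\<close> is
    \<open>0\<close>.\<close>
  then have "n = 1" using pos(1) by simp
  then show ?thesis by simp
qed

end

theorem theorem13:
  fixes params :: "(nat \<times> nat \<times> nat) set"
  assumes params: "params = {(n, c, k). 1 \<le> c \<and> c \<le> k \<and> k \<le> n}"
  shows "\<exists>(A :: nat \<times> nat \<times> nat \<Rightarrow> (nat set, nat set update, nat \<Rightarrow> nat set set) stream_alg)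
          (passes :: nat \<times> nat \<times> nat \<Rightarrow> nat) (space :: nat \<times> nat \<times> nat \<Rightarrow> nat) (\<alpha> :: real).
     \<alpha> > 0 \<and>
     (\<lambda>x. real (passes x)) \<in> soft_O params (\<lambda>(n, c, k). n) (\<lambda>(n, c, k). real n / real k) \<and>
     (\<lambda>x. real (space x)) \<in> soft_O params (\<lambda>(n, c, k). n) (\<lambda>(n, c, k). real c * real n + real k ^ 2) \<and>
     (\<forall>(n, c, k) \<in> params.
        uses_space (A (n, c, k)) (space (n, c, k)) \<and>
        (\<forall>S us. S \<subseteq> {..<n} \<longrightarrow> card S = c \<longrightarrow> turnstile_stream n us \<longrightarrow>
           measure_pmf.prob (run_alg (A (n, c, k)) (passes (n, c, k)) S us)
             {T. \<forall>r\<in>S. bfs_tree (final_graph us) r (T r)} \<ge> 1 - 1 / real n powr \<alpha>))"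
proof -
  have loc: "bfs_params n c k" if "(n, c, k) \<in> params" for n c k
    using that by unfold_locales (auto simp: params)
  let ?A = "\<lambda>(n, c, k). bfs_params.algorithm n c k"
  let ?passes = "\<lambda>(n, c, k). bfs_params.passes n c k"
  let ?space = "\<lambda>(n, c, k). bfs_params.bits n c k"
  show ?thesis
  proof (rule exI[of _ ?A], rule exI[of _ ?passes], rule exI[of _ ?space], rule exI[of _ "1 :: real"], intro conjI)
    show "(\<lambda>x. real (?passes x)) \<in> soft_O params (\<lambda>(n, c, k). n) (\<lambda>(n, c, k). real n / real k)"
      unfolding soft_O_def using bfs_params.passes_le[OF loc]
      by (auto intro!: exI[of _ "100 :: real"] exI[of _ "2 :: nat"])
    show "(\<lambda>x. real (?space x)) \<in> soft_O params (\<lambda>(n, c, k). n) (\<lambda>(n, c, k). real c * real n + real k ^ 2)"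
      unfolding soft_O_def using bfs_params.bits_le[OF loc]
      by (auto intro!: exI[of _ "200 :: real"] exI[of _ "2 :: nat"])
    show "\<forall>(n, c, k) \<in> params. uses_space (?A (n, c, k)) (?space (n, c, k)) \<and>
        (\<forall>S us. S \<subseteq> {..<n} \<longrightarrow> card S = c \<longrightarrow> turnstile_stream n us \<longrightarrow>
           measure_pmf.prob (run_alg (?A (n, c, k)) (?passes (n, c, k)) S us)
             {T. \<forall>r\<in>S. bfs_tree (final_graph us) r (T r)} \<ge> 1 - 1 / real n powr 1)"
      using bfs_params.uses_space_algorithm[OF loc] bfs_params.algorithm_correct[OF loc] by auto
  qed simp
qed

end
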